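(* Let $d\ge1$, let $L$ be a (homogeneous) Poisson point process on $\mathbb{R}^d$ of intensity $\lambda\in(0,\infty)$, and fix $c>0$. With probability $1$: (i) shy friendly frogs on $L$ with constant $c$ is a win for Alice; (ii) shy colored friendly frogs on $L$ with constant $c$ is a win for Bob.
   Context: Distances are Euclidean. The realization of the Poisson process is regarded as a random (countable) set $L$ of points. Friendly frogs on a set $L\subset\mathbb{R}^d$ is the following two-player game. First Alice chooses a point of $L$ and places a frog on it. Then Bob places a second frog on a different point of $L$. Then the players alternately move, starting with Alice. A move consists of moving either one of the two frogs (both players may move either frog) to another point of $L$, in such a way that the distance between the two frogs is strictly decreased and the two frogs do not occupy the same point. A player who cannot move loses, and the other player wins. Colored friendly frogs has the same rules except that Alice's opening frog is amber, Bob's opening frog is blue, and subsequently Alice may only move the amber frog and Bob may only move the blue frog. In the shy version (of either game) with constant $c>0$, there is the additional rule that Bob, on his opening move, cannot place the second frog within distance $c$ of the first frog; there is no such restriction on subsequent moves. A strategy for a player assigns a legal move (if one exists) to each position; a winning strategy is one that results in a win for that player whatever strategy the other player uses. The game is a win for a player if that player has a winning strategy. The players know the realization of $L$. *)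

theory Defs
  imports "HOL-Probability.Probability"
begin

text \<open>
  Point configurations are sets, so \<^term>\<open>card (L \<omega> \<inter> B)\<close> is the number of points in \<^term>\<open>B\<close>.
  The law of this number is written out, instead of using \<^const>\<open>poisson_pmf\<close>, so that sets
  \<^term>\<open>B\<close> of volume 0 are covered (with \<open>0 ^ 0 = 1\<close>).
\<close>

locale poisson_point_process = prob_space M
  for M :: "'w measure" +
  fixes L :: "'w \<Rightarrow> 'a::euclidean_space set"
    and intensity :: real
  assumes locally_finite: "AE \<omega> in M. \<forall>B. bounded B \<longrightarrow> finite (L \<omega> \<inter> B)"
    and measurable_count: "\<And>B. B \<in> sets borel \<Longrightarrow> bounded B \<Longrightarrow>
          (\<lambda>\<omega>. card (L \<omega> \<inter> B)) \<in> measurable M (count_space UNIV)"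
    and poisson_count: "\<And>B k. B \<in> sets borel \<Longrightarrow> bounded B \<Longrightarrow>
          prob {\<omega> \<in> space M. card (L \<omega> \<inter> B) = k} =
            (intensity * measure lborel B) ^ k / fact k * exp (- (intensity * measure lborel B))"
    and indep_counts: "\<And>(B :: nat \<Rightarrow> 'a set) n.
          (\<And>i. i < n \<Longrightarrow> B i \<in> sets borel \<and> bounded (B i)) \<Longrightarrow>
          disjoint_family_on B {..<n} \<Longrightarrow>
          indep_vars (\<lambda>_. count_space UNIV) (\<lambda>i \<omega>. card (L \<omega> \<inter> B i)) {..<n}"

datatype player = Alice | Bob

fun opponent :: "player \<Rightarrow> player" where
  "opponent Alice = Bob"
| "opponent Bob = Alice"

text \<open>
  \<open>Frogs p x y\<close>: player \<open>p\<close> is to move, the frog placed by Alice (amber) is at \<open>x\<close>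
  and the frog placed by Bob (blue) is at \<open>y\<close>.
\<close>

datatype 'a position = Start | Opened 'a | Frogs player 'a 'a

fun turn :: "'a position \<Rightarrow> player" where
  "turn Start = Alice"
| "turn (Opened x) = Bob"
| "turn (Frogs p x y) = p"

text \<open>
  Destinations of a frog at \<open>x\<close> when the other frog is at \<open>y\<close>; the strict decrease of the
  distance already forces the destination to differ from \<open>x\<close>.
\<close>

definition jumps :: "'a::metric_space set \<Rightarrow> 'a \<Rightarrow> 'a \<Rightarrow> 'a set" where
  "jumps L x y = {z \<in> L. z \<noteq> y \<and> dist z y < dist x y}"

definition shy_replies :: "real \<Rightarrow> 'a::metric_space set \<Rightarrow> 'a \<Rightarrow> 'a set" where
  "shy_replies c L x = {y \<in> L. y \<noteq> x \<and> \<not> dist x y \<le> c}"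

fun shy_friendly_frogs :: "real \<Rightarrow> 'a::metric_space set \<Rightarrow> 'a position \<Rightarrow> 'a position set" where
  "shy_friendly_frogs c L Start = Opened ` L"
| "shy_friendly_frogs c L (Opened x) = Frogs Alice x ` shy_replies c L x"
| "shy_friendly_frogs c L (Frogs p x y) =
     (\<lambda>x'. Frogs (opponent p) x' y) ` jumps L x y \<union> (\<lambda>y'. Frogs (opponent p) x y') ` jumps L y x"

fun shy_colored_friendly_frogs ::
    "real \<Rightarrow> 'a::metric_space set \<Rightarrow> 'a position \<Rightarrow> 'a position set" where
  "shy_colored_friendly_frogs c L Start = Opened ` L"
| "shy_colored_friendly_frogs c L (Opened x) = Frogs Alice x ` shy_replies c L x"
| "shy_colored_friendly_frogs c L (Frogs Alice x y) = (\<lambda>x'. Frogs Bob x' y) ` jumps L x y"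
| "shy_colored_friendly_frogs c L (Frogs Bob x y) = (\<lambda>y'. Frogs Alice x y') ` jumps L y x"

text \<open>
  A game is given by its function \<open>G\<close> from positions to the sets of positions
  reachable in one legal move.
\<close>

definition is_strategy ::
    "('a position \<Rightarrow> 'a position set) \<Rightarrow> player \<Rightarrow> ('a position \<Rightarrow> 'a position) \<Rightarrow> bool" where
  "is_strategy G p \<sigma> \<longleftrightarrow> (\<forall>s. turn s = p \<and> G s \<noteq> {} \<longrightarrow> \<sigma> s \<in> G s)"

text \<open>
  \<open>play G p \<sigma> \<tau>\<close> is the play from \<open>Start\<close> in which \<open>p\<close> follows \<open>\<sigma>\<close> and the opponent
  follows \<open>\<tau>\<close>; once the player to move is stuck, the position is repeated forever.
\<close>

fun play :: "('a position \<Rightarrow> 'a position set) \<Rightarrow> player \<Rightarrow> ('a position \<Rightarrow> 'a position) \<Rightarrow>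
    ('a position \<Rightarrow> 'a position) \<Rightarrow> nat \<Rightarrow> 'a position" where
  "play G p \<sigma> \<tau> 0 = Start"
| "play G p \<sigma> \<tau> (Suc n) =
     (let s = play G p \<sigma> \<tau> n
      in if G s = {} then s else if turn s = p then \<sigma> s else \<tau> s)"

text \<open>
  A play that goes on forever is won by neither player.
\<close>

definition winning_strategy ::
    "('a position \<Rightarrow> 'a position set) \<Rightarrow> player \<Rightarrow> ('a position \<Rightarrow> 'a position) \<Rightarrow> bool" where
  "winning_strategy G p \<sigma> \<longleftrightarrow> is_strategy G p \<sigma> \<and>
     (\<forall>\<tau>. is_strategy G (opponent p) \<tau> \<longrightarrow>
       (\<exists>n. G (play G p \<sigma> \<tau> n) = {} \<and> turn (play G p \<sigma> \<tau> n) = opponent p))"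

definition win_for :: "('a position \<Rightarrow> 'a position set) \<Rightarrow> player \<Rightarrow> bool" where
  "win_for G p \<longleftrightarrow> (\<exists>\<sigma>. winning_strategy G p \<sigma>)"

end

theory Submission
  imports Defs
begin

text \<open>
  Match the points of \<open>L\<close> stably, each point preferring nearby partners; say that \<open>y\<close> desires \<open>x\<close>
  if \<open>y\<close> is not matched to a point closer than \<open>x\<close>. Almost surely there are no ties and no infinite
  descending chains of distances, so that of two points not matched to each other at least one is
  matched to a strictly closer point.

  Alice wins the shy game by opening with one point of a mutually nearest pair at distance at most
  \<open>c\<close>: her second move completes the pair and Bob is stuck.

  In the coloured game Bob always moves to the partner of the amber frog, which keeps the
  invariant that, when Alice is to move, the point of the blue frog desires that of the amber frog.
  So he only needs, for each opening point \<open>x\<close>, a point \<open>y\<close> at distance more than \<open>c\<close> that desires \<open>x\<close>.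
  Suppose that with positive probability some \<open>x\<close> is desired by no far point. Then only
  finitely many points desire \<open>x\<close>; giving each of them, and each of their partners other than \<open>x\<close>,
  a companion in its own tiny cell makes these pairs match and leaves \<open>x\<close> unmatched and undesired.
  Going from one to two points in finitely many fixed cells costs only a constant factor in probability.
  Hence the probability that some point of a fixed ball is not desired by any point within distance
  \<open>R\<close> stays bounded away from \<open>0\<close> as \<open>R\<close> grows. But two such points have distance at least
  \<open>R\<close>, so translation invariance bounds this probability by the inverse of the number of
  disjoint translates of the ball that fit into a region of diameter \<open>R\<close>.
\<close>

section \<open>Stable matching and the two games\<close>

definition loc_finite :: "'a::metric_space set \<Rightarrow> bool" where
  "loc_finite L \<longleftrightarrow> (\<forall>B. bounded B \<longrightarrow> finite (L \<inter> B))"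

definition no_isosceles :: "'a::metric_space set \<Rightarrow> bool" where
  "no_isosceles L \<longleftrightarrow> (\<forall>x\<in>L. inj_on (dist x) L)"

text \<open>Only the new pair has to lie in \<open>L\<close>. Every move of a frog between points of
  \<open>L\<close> is a step of this relation, so its well-foundedness serves both the matching and
  the termination of play.\<close>

definition descent :: "'a::metric_space set \<Rightarrow> (('a \<times> 'a) \<times> ('a \<times> 'a)) set" where
  "descent L = {((x', y'), (x, y)). x' \<in> L \<and> y' \<in> L \<and> x' \<noteq> y' \<and> dist x' y' < dist x y \<and>
     {x', y'} \<inter> {x, y} \<noteq> {}}"

text \<open>
  The least fixed point contains exactly the pairs whose matching is forced by well-founded
  reasoning. The weak inequality in the premise excludes ties and is what makes the
  relation stable under small perturbations of \<open>L\<close>.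
\<close>

inductive matched :: "'a::metric_space set \<Rightarrow> 'a \<Rightarrow> 'a \<Rightarrow> bool" for L where
  matchedI: "\<lbrakk>x \<in> L; y \<in> L; x \<noteq> y;
    \<forall>u\<in>L - {x, y}. \<forall>w\<in>{x, y}. dist u w \<le> dist x y \<longrightarrow> (\<exists>v. matched L u v \<and> dist u v < dist u w)\<rbrakk>
    \<Longrightarrow> matched L x y"

text \<open>The negation is desire: \<open>y\<close> desires \<open>x\<close>. An unmatched point
  desires every point.\<close>

definition closer_matched :: "'a::metric_space set \<Rightarrow> 'a \<Rightarrow> 'a \<Rightarrow> bool" where
  "closer_matched L y x \<longleftrightarrow> (\<exists>v. matched L y v \<and> dist y v < dist y x)"

lemma matched_sym: "matched L x y \<Longrightarrow> matched L y x"
proof (induction rule: matched.induct)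
  case (matchedI x y)
  then show ?case by (intro matched.intros) (auto simp: dist_commute insert_commute)
qed

lemma matched_in: assumes "matched L x y" shows "x \<in> L" "y \<in> L" "x \<noteq> y"
  using assms by (cases; simp)+

lemma matched_near:
  assumes "matched L x y" "u \<in> L" "u \<noteq> x" "u \<noteq> y" "w \<in> {x, y}" "dist u w \<le> dist x y"
  shows "closer_matched L u w"
  using assms by cases (auto simp: closer_matched_def)

text \<open>The induction hypothesis gives each competitor of \<open>x\<close> and \<open>y\<close>
  a unique partner that is strictly closer. A second partner \<open>z\<close> of \<open>x\<close> no
  farther than \<open>y\<close> would be such a competitor, yet it is matched to \<open>x\<close>.
  If \<open>z\<close> is farther, then \<open>y\<close> has a closer partner \<open>v\<close>, which
  is such a competitor, yet matched to \<open>y\<close>.\<close>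

lemma matched_unique: "matched L x y \<Longrightarrow> matched L x z \<Longrightarrow> z = y"
proof (induction arbitrary: z rule: matched.induct)
  case (matchedI x y)
  have near: "\<exists>v. (matched L u v \<and> (\<forall>t. matched L u t \<longrightarrow> t = v)) \<and> dist u v < dist u w"
    if "u \<in> L" "u \<noteq> x" "u \<noteq> y" "w \<in> {x, y}" "dist u w \<le> dist x y" for u w
    using matchedI.IH that by blast
  show ?case
  proof (rule ccontr)
    assume zy: "z \<noteq> y"
    note z = matched_in[OF matchedI.prems]
    show False
    proof (cases "dist x z \<le> dist x y")
      case True
      then obtain v where v: "\<forall>t. matched L z t \<longrightarrow> t = v" "dist z v < dist z x"
        using near[of z x] z zy by (auto simp: dist_commute)
      then show False using matched_sym[OF matchedI.prems] by auto
    next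
      case False
      then obtain v where v: "matched L y v" "dist y v < dist y x"
        using matched_near[OF matchedI.prems, of y x] zy matchedI.hyps
        by (auto simp: closer_matched_def dist_commute)
      have "v \<noteq> x" using v by auto
      moreover have "v \<noteq> y" using matched_in[OF v(1)] by auto
      ultimately obtain w where w: "\<forall>t. matched L v t \<longrightarrow> t = w" "dist v w < dist v y"
        using near[of v y] matched_in[OF v(1)] v(2) by (auto simp: dist_commute)
      then show False using matched_sym[OF v(1)] by auto
    qed
  qed
qed

text \<open>Induction along \<open>descent\<close>: if neither point is matched closer, the rule for
  \<open>matched\<close> applies, because each competitor forms with a point of the pair a shorter
  pair that is already decided.\<close>

lemma matched_decided:
  assumes wf: "wf (descent L)" and iso: "no_isosceles L"
    and "x \<in> L" "y \<in> L" "x \<noteq> y"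
  shows "matched L x y \<or> closer_matched L x y \<or> closer_matched L y x"
proof -
  define P where "P = (\<lambda>(x, y). x \<in> L \<longrightarrow> y \<in> L \<longrightarrow> x \<noteq> y \<longrightarrow>
    matched L x y \<or> closer_matched L x y \<or> closer_matched L y x)"
  have "P (x, y)"
  proof (induction rule: wf_induct_rule[OF wf])
    case (1 e)
    obtain x y where e: "e = (x, y)" by (cases e)
    have "matched L x y" if x: "x \<in> L" "y \<in> L" "x \<noteq> y"
      and n: "\<not> closer_matched L x y" "\<not> closer_matched L y x"
    proof (rule matchedI[OF x], intro ballI impI)
      fix u w assume u: "u \<in> L - {x, y}" and w: "w \<in> {x, y}" and d: "dist u w \<le> dist x y"
      have wL: "w \<in> L" "u \<noteq> w" using w x u by auto
      \<comment> \<open>With a tie, \<open>w\<close> would be equidistant from \<open>u\<close> and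
        from the other point \<open>w'\<close> of the pair.\<close>
      have lt: "dist u w < dist x y"
      proof (rule ccontr)
        assume "\<not> ?thesis"
        then have "dist u w = dist x y" using d by simp
        moreover obtain w' where "{w, w'} = {x, y}" "w' \<in> L" "w' \<noteq> u"
          using w x u by (auto simp: insert_commute)
        ultimately have "dist w u = dist w w'" by (auto simp: doubleton_eq_iff dist_commute)
        moreover have "inj_on (dist w) L" using iso wL by (simp add: no_isosceles_def)
        ultimately show False using \<open>w' \<in> L\<close> \<open>w' \<noteq> u\<close> u by (auto dest: inj_onD)
      qed
      then have "((u, w), e) \<in> descent L" using wL u w by (auto simp: descent_def e)
      then have "P (u, w)" by (rule 1)
      then have c: "matched L u w \<or> closer_matched L u w \<or> closer_matched L w u"
        using wL u by (auto simp: P_def)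
      \<comment> \<open>A partner of \<open>w\<close> within distance \<open>dist u w\<close> would
        be closer to \<open>w\<close> than the other point of the pair, which \<open>n\<close>
        excludes. So in \<open>c\<close> only the case remains that \<open>u\<close> is matched
        closer.\<close>
      have "closer_matched L w w''" if "\<exists>v. matched L w v \<and> dist w v \<le> dist u w"
        "w'' \<in> {x, y}" "w'' \<noteq> w" for w''
        using that lt w by (auto simp: closer_matched_def dist_commute intro: exI)
      then have "\<not> (\<exists>v. matched L w v \<and> dist w v \<le> dist u w)"
        using n w x by auto
      then have "closer_matched L u w"
        using c matched_sym[of L u w] by (auto simp: closer_matched_def dist_commute)
      then show "\<exists>v. matched L u v \<and> dist u v < dist u w" by (simp add: closer_matched_def)
    qed
    then show ?case by (auto simp: P_def e)
  qed
  then show ?thesis using assms by (simp add: P_def)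
qed

section \<open>Winning by an invariant set of positions\<close>

text \<open>Play that stays in \<open>I\<close> terminates by \<open>wf\<close>, and it cannot stop
  where \<open>p\<close> is to move, because there a move within \<open>I\<close> exists.\<close>

lemma win_forI:
  assumes wf: "wf {(t, s). s \<in> I \<and> t \<in> I \<and> t \<in> G s}"
    and start: "Start \<in> I"
    and own: "\<And>s. s \<in> I \<Longrightarrow> turn s = p \<Longrightarrow> G s \<inter> I \<noteq> {}"
    and opp: "\<And>s. s \<in> I \<Longrightarrow> turn s \<noteq> p \<Longrightarrow> G s \<subseteq> I"
  shows "win_for G p"
proof -
  \<comment> \<open>Outside \<open>I\<close> any legal move serves; it only makes \<sigma> a
    strategy on all positions.\<close>
  define \<sigma> where "\<sigma> s = (if s \<in> I then SOME t. t \<in> G s \<inter> I else SOME t. t \<in> G s)" for s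
  have \<sigma>I: "\<sigma> s \<in> G s \<inter> I" if "s \<in> I" "turn s = p" for s
    using own[OF that] that someI_ex[of "\<lambda>t. t \<in> G s \<inter> I"] unfolding \<sigma>_def by auto
  have \<sigma>: "is_strategy G p \<sigma>"
    unfolding is_strategy_def
  proof (intro allI impI, elim conjE)
    fix s assume "turn s = p" "G s \<noteq> {}"
    then show "\<sigma> s \<in> G s" using \<sigma>I[of s] by (cases "s \<in> I") (auto simp: \<sigma>_def some_in_eq)
  qed
  have "\<exists>n. G (play G p \<sigma> \<tau> n) = {} \<and> turn (play G p \<sigma> \<tau> n) = opponent p"
    if \<tau>: "is_strategy G (opponent p) \<tau>" for \<tau>
  proof -
    define f where "f = play G p \<sigma> \<tau>"
    have opponent: "turn s = opponent p" if "turn s \<noteq> p" for s :: "'a position"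
      using that by (cases p; cases "turn s") auto
    have step: "f (Suc n) \<in> I \<and> (G (f n) \<noteq> {} \<longrightarrow> f (Suc n) \<in> G (f n))" if "f n \<in> I" for n
      using \<sigma>I[of "f n"] opp[of "f n"] opponent[of "f n"] that \<tau>
      by (auto simp: f_def Let_def is_strategy_def)
    have inI: "f n \<in> I" for n
      by (induction n) (use step start in \<open>auto simp: f_def\<close>)
    have "\<exists>n. G (f n) = {}"
    proof (rule ccontr)
      assume "\<not> ?thesis"
      then have "\<forall>n. (f (Suc n), f n) \<in> {(t, s). s \<in> I \<and> t \<in> I \<and> t \<in> G s}"
        using step inI by auto
      then show False using wf by (auto simp: wf_iff_no_infinite_down_chain)
    qed
    then obtain n where "G (f n) = {}" by auto
    then show ?thesis using own[OF inI[of n]] opponent[of "f n"] by (auto simp: f_def)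
  qed
  then show ?thesis using \<sigma> by (auto simp: win_for_def winning_strategy_def)
qed

lemma Alice_wins_shy:
  assumes wf: "wf (descent L)" and x: "x \<in> L" "y \<in> L" "x \<noteq> y" "dist x y \<le> c"
  shows "win_for (shy_friendly_frogs c L) Alice"
proof -
  let ?Q = "{(x, y). x \<in> L \<and> y \<in> L \<and> x \<noteq> y \<and> dist x y \<le> c}"
  from wf x obtain e where e: "e \<in> ?Q" and min: "\<And>e'. (e', e) \<in> descent L \<Longrightarrow> e' \<notin> ?Q"
    using wfE_min[OF wf, of "(x, y)" ?Q] by auto
  obtain a b where ab: "a \<in> L" "b \<in> L" "a \<noteq> b" "dist a b \<le> c" "e = (a, b)" using e by auto
  \<comment> \<open>The pair is minimal among those at distance at most \<open>c\<close>: a jump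
    would produce a shorter such pair that shares a point with it.\<close>
  have stuck: "jumps L a b = {}" "jumps L b a = {}"
    using min ab by (force simp: jumps_def descent_def dist_commute)+
  define I where "I = {Start, Opened a, Frogs Bob a b} \<union> Frogs Alice a ` shy_replies c L a"
  define rank :: "'a position \<Rightarrow> nat" where
    "rank s = (case s of Start \<Rightarrow> 3 | Opened _ \<Rightarrow> 2 | Frogs q _ _ \<Rightarrow> (if q = Alice then 1 else 0))" for s
  show ?thesis
  proof (rule win_forI[where I = I])
    have "{(t, s). s \<in> I \<and> t \<in> I \<and> t \<in> shy_friendly_frogs c L s} \<subseteq> Wellfounded.measure rank"
      using stuck by (auto simp: I_def rank_def)
    then show "wf {(t, s). s \<in> I \<and> t \<in> I \<and> t \<in> shy_friendly_frogs c L s}"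
      by (rule wf_subset[OF wf_measure])
    show "shy_friendly_frogs c L s \<inter> I \<noteq> {}" if "s \<in> I" "turn s = Alice" for s
    proof -
      \<comment> \<open>Alice moves the blue frog from \<open>y\<close> to \<open>b\<close>: the shy
        rule puts \<open>y\<close> farther than \<open>c\<close> from \<open>a\<close>, while
        \<open>b\<close> is within \<open>c\<close>.\<close>
      have "b \<in> jumps L y a" if "y \<in> shy_replies c L a" for y
        using that ab by (auto simp: jumps_def shy_replies_def dist_commute)
      then show ?thesis using that ab by (auto simp: I_def)
    qed
    show "shy_friendly_frogs c L s \<subseteq> I" if "s \<in> I" "turn s \<noteq> Alice" for s
      using that stuck by (auto simp: I_def)
  qed (simp add: I_def)
qed

lemma Bob_wins_shy_colored:
  assumes wf: "wf (descent L)" and iso: "no_isosceles L"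
    and far: "\<And>x. x \<in> L \<Longrightarrow> \<exists>y\<in>L. dist x y > c \<and> \<not> closer_matched L y x" and c: "c > 0"
  shows "win_for (shy_colored_friendly_frogs c L) Bob"
proof -
  let ?G = "shy_colored_friendly_frogs c L"
  \<comment> \<open>With Bob to move the two points are also not matched to each other; together
    with desire this forces \<open>x\<close> to have a partner closer than \<open>y\<close>.\<close>
  define I where "I = insert Start (Opened ` L) \<union>
    {Frogs Alice x y | x y. x \<in> L \<and> y \<in> L \<and> x \<noteq> y \<and> \<not> closer_matched L y x} \<union>
    {Frogs Bob x y | x y. x \<in> L \<and> y \<in> L \<and> x \<noteq> y \<and> \<not> matched L x y \<and> \<not> closer_matched L y x}"
  show ?thesis
  proof (rule win_forI[where I = I])
    define rank :: "'a position \<Rightarrow> nat" where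
      "rank s = (case s of Start \<Rightarrow> 2 | Opened _ \<Rightarrow> 1 | Frogs q _ _ \<Rightarrow> 0)" for s
    \<comment> \<open>\<open>pts\<close> is unspecified before both frogs are placed; there
      \<open>rank\<close> already drops.\<close>
    define pts where "pts s = (case s of Frogs q x y \<Rightarrow> (x, y))" for s :: "'a position"
    have "{(t, s). s \<in> I \<and> t \<in> I \<and> t \<in> ?G s} \<subseteq> inv_image (less_than <*lex*> descent L) (\<lambda>s. (rank s, pts s))"
    proof safe
      fix s t assume "s \<in> I" "t \<in> I" "t \<in> ?G s"
      then show "(t, s) \<in> inv_image (less_than <*lex*> descent L) (\<lambda>s. (rank s, pts s))"
        by (auto simp: I_def rank_def pts_def descent_def jumps_def dist_commute)
    qed
    then show "wf {(t, s). s \<in> I \<and> t \<in> I \<and> t \<in> ?G s}"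
      by (rule wf_subset[rotated]) (intro wf_inv_image wf_lex_prod wf_less_than wf)
    show "?G s \<inter> I \<noteq> {}" if s: "s \<in> I" "turn s = Bob" for s
    proof (cases s)
      case (Opened x)
      then obtain y where "x \<in> L" "y \<in> L" "dist x y > c" "\<not> closer_matched L y x"
        using s far[of x] by (auto simp: I_def)
      moreover have "x \<noteq> y" using \<open>dist x y > c\<close> c by auto
      ultimately have "Frogs Alice x y \<in> ?G s \<inter> I" by (auto simp: Opened I_def shy_replies_def)
      then show ?thesis by blast
    next
      case (Frogs q x y)
      have q: "q = Bob" using s Frogs by simp
      have xy: "x \<in> L" "y \<in> L" "x \<noteq> y" "\<not> matched L x y" "\<not> closer_matched L y x"
        using s Frogs q by (auto simp: I_def)
      then obtain v where v: "matched L x v" "dist x v < dist x y"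
        using matched_decided[OF wf iso, of x y] by (auto simp: closer_matched_def)
      \<comment> \<open>The partner of the amber point desires it, since by uniqueness its only
        partner is \<open>x\<close>.\<close>
      have "\<not> closer_matched L v x"
        using matched_unique[OF matched_sym[OF v(1)]] by (auto simp: closer_matched_def)
      then show ?thesis using matched_in[OF v(1)] v(2)
        by (auto simp: Frogs q I_def jumps_def dist_commute)
    qed (use s in auto)
    show "?G s \<subseteq> I" if s: "s \<in> I" "turn s \<noteq> Bob" for s
    proof (cases s)
      case (Frogs q x y)
      have q: "q = Alice" using s Frogs by (cases q) auto
      have xy: "x \<in> L" "y \<in> L" "x \<noteq> y" "\<not> closer_matched L y x"
        using s Frogs q by (auto simp: I_def)
      \<comment> \<open>Alice has shortened the distance, so a partner of \<open>y\<close> at the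
        new distance or less would have been closer than \<open>x\<close>.\<close>
      have "\<not> matched L x' y \<and> \<not> closer_matched L y x'" if "dist x' y < dist x y" for x'
        using xy(4) that matched_sym[of L x' y] by (force simp: closer_matched_def dist_commute)
      then show ?thesis using xy by (auto simp: Frogs q I_def jumps_def)
    qed (use s in \<open>auto simp: I_def\<close>)
  qed (simp add: I_def)
qed

section \<open>Dyadic cells\<close>

text \<open>The integer index of the half-open dyadic cube of side 2^-n that contains
  \<open>x\<close>. Indices instead of corners let one lattice label the cells of all
  levels.\<close>

definition snap :: "nat \<Rightarrow> 'a::euclidean_space \<Rightarrow> 'a" where
  "snap n x = (\<Sum>i\<in>Basis. of_int \<lfloor>2 ^ n * (x \<bullet> i)\<rfloor> *\<^sub>R i)"

definition integral_points :: "'a::euclidean_space set" where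
  "integral_points = {z. \<forall>i\<in>Basis. z \<bullet> i \<in> \<int>}"

definition cell :: "nat \<Rightarrow> 'a::euclidean_space \<Rightarrow> 'a set" where
  "cell n z = {x. snap n x = z}"

text \<open>A bound for the diameter of a cell, obtained through the l1 norm.\<close>

definition mesh :: "'a::euclidean_space itself \<Rightarrow> nat \<Rightarrow> real" where
  "mesh _ n = real DIM('a) / 2 ^ n"

text \<open>The one parameter \<open>n\<close> both refines the cells and enlarges the region they
  cover, so that letting \<open>n\<close> grow eventually sees everything.\<close>

definition window :: "nat \<Rightarrow> 'a::euclidean_space set" where
  "window n = {z \<in> integral_points. \<forall>i\<in>Basis. \<bar>z \<bullet> i\<bar> \<le> real n * 2 ^ n}"

lemma snap_inner: "i \<in> Basis \<Longrightarrow> snap n x \<bullet> i = of_int \<lfloor>2 ^ n * (x \<bullet> i)\<rfloor>"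
  by (simp add: snap_def inner_sum_left_Basis)

lemma snap_integral: "snap n x \<in> integral_points"
  by (simp add: integral_points_def snap_inner)

lemma snap_eq_iff: "snap n x = snap n y \<longleftrightarrow> (\<forall>i\<in>Basis. \<lfloor>2 ^ n * (x \<bullet> i)\<rfloor> = \<lfloor>2 ^ n * (y \<bullet> i)\<rfloor>)"
  by (simp add: euclidean_eq_iff[of "snap n x"] snap_inner)

lemma snap_dist:
  fixes x y :: "'a::euclidean_space"
  assumes "snap n x = snap n y"
  shows "dist x y \<le> mesh TYPE('a) n"
proof -
  have "\<bar>(x - y) \<bullet> i\<bar> \<le> 1 / 2 ^ n" if "i \<in> Basis" for i
  proof -
    have "\<bar>2 ^ n * (x \<bullet> i) - 2 ^ n * (y \<bullet> i)\<bar> \<le> 1"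
      using assms that unfolding snap_eq_iff by (smt (verit) floor_correct of_int_add of_int_1)
    moreover have "2 ^ n * \<bar>(x - y) \<bullet> i\<bar> = \<bar>2 ^ n * (x \<bullet> i) - 2 ^ n * (y \<bullet> i)\<bar>"
      by (simp add: inner_diff_left abs_mult flip: right_diff_distrib)
    ultimately have "2 ^ n * \<bar>(x - y) \<bullet> i\<bar> \<le> 1" by simp
    then show ?thesis by (simp add: field_simps)
  qed
  then have "(\<Sum>i\<in>Basis. \<bar>(x - y) \<bullet> i\<bar>) \<le> (\<Sum>i\<in>(Basis::'a set). 1 / 2 ^ n)"
    by (rule sum_mono)
  then show ?thesis using norm_le_l1[of "x - y"] by (simp add: dist_norm mesh_def)
qed

text \<open>Dividing by a positive integer commutes with the floor, so the coarse index is a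
  function of the fine one.\<close>

lemma snap_coarsen:
  assumes "n \<le> m" "snap m x = snap m y"
  shows "snap n x = snap n y"
proof -
  have "\<lfloor>2 ^ n * a\<rfloor> = \<lfloor>2 ^ m * a\<rfloor> div 2 ^ (m - n)" for a :: real
  proof -
    have "2 ^ n * a = 2 ^ m * a / of_int (2 ^ (m - n))"
      using assms(1) by (auto simp: le_iff_add power_add)
    then show ?thesis by (simp only: floor_divide_real_eq_div zero_le_power zero_le_numeral)
  qed
  then show ?thesis using assms(2) by (simp add: snap_eq_iff)
qed

lemma mesh_pos: "0 < mesh TYPE('a::euclidean_space) n"
  by (simp add: mesh_def)

lemma mesh_antimono: "n \<le> m \<Longrightarrow> mesh TYPE('a::euclidean_space) m \<le> mesh TYPE('a) n"
  by (simp add: mesh_def frac_le)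

lemma mesh_tendsto: "(\<lambda>n. mesh TYPE('a::euclidean_space) n) \<longlonglongrightarrow> 0"
proof -
  have "(\<lambda>n. real DIM('a) * (1 / 2) ^ n) \<longlonglongrightarrow> real DIM('a) * 0"
    by (intro tendsto_intros LIMSEQ_realpow_zero) auto
  then show ?thesis by (simp add: mesh_def power_divide)
qed

lemma eventually_mesh_less:
  assumes "e > 0" shows "\<forall>\<^sub>F n in sequentially. k * mesh TYPE('a::euclidean_space) n < e"
proof -
  have "(\<lambda>n. k * mesh TYPE('a) n) \<longlonglongrightarrow> k * 0" by (intro tendsto_intros mesh_tendsto)
  then show ?thesis using assms by (auto dest: order_tendstoD)
qed

lemma cell_disjoint: "y \<noteq> z \<Longrightarrow> cell n y \<inter> cell n z = {}"
  by (auto simp: cell_def)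

lemma bounded_cell: "bounded (cell n (z::'a::euclidean_space))"
proof (cases "cell n z = {}")
  case False
  then obtain x where "x \<in> cell n z" by auto
  then have "cell n z \<subseteq> cball x (mesh TYPE('a) n)" by (auto simp: cell_def intro!: snap_dist)
  then show ?thesis by (rule bounded_subset[OF bounded_cball])
qed simp

lemma finite_integral_points:
  assumes "bounded (B::'a::euclidean_space set)"
  shows "finite (integral_points \<inter> B)"
proof -
  from assms obtain r where r: "\<And>x. x \<in> B \<Longrightarrow> norm x \<le> r" by (auto simp: bounded_iff)
  define f where "f z = (\<lambda>i. if i \<in> Basis then z \<bullet> i else undefined)" for z :: 'a
  have "finite (PiE Basis (\<lambda>i::'a. real_of_int ` {-\<lceil>r\<rceil>..\<lceil>r\<rceil>}))" by (intro finite_PiE) auto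
  moreover have "f ` (integral_points \<inter> B) \<subseteq> PiE Basis (\<lambda>i. real_of_int ` {-\<lceil>r\<rceil>..\<lceil>r\<rceil>})"
  proof (rule image_subsetI)
    fix z :: 'a assume "z \<in> integral_points \<inter> B"
    then have z: "z \<in> integral_points" "z \<in> B" by auto
    show "f z \<in> PiE Basis (\<lambda>i. real_of_int ` {-\<lceil>r\<rceil>..\<lceil>r\<rceil>})"
    proof (rule PiE_I)
      fix i :: 'a assume i: "i \<in> Basis"
      then obtain k where k: "z \<bullet> i = of_int k" using z by (auto simp: integral_points_def Ints_def)
      have "\<bar>of_int k\<bar> \<le> r" using Basis_le_norm[OF i, of z] r[OF z(2)] k by simp
      then have "k \<in> {-\<lceil>r\<rceil>..\<lceil>r\<rceil>}" by (simp add: abs_le_iff) linarith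
      then show "f z i \<in> real_of_int ` {-\<lceil>r\<rceil>..\<lceil>r\<rceil>}" using k i by (auto simp: f_def)
    qed (simp add: f_def)
  qed
  ultimately have "finite (f ` (integral_points \<inter> B))" by (rule rev_finite_subset)
  moreover have "inj f"
  proof (rule injI, rule euclidean_eqI)
    fix y z i :: 'a assume "f y = f z" "i \<in> Basis"
    then show "y \<bullet> i = z \<bullet> i" by (auto simp: f_def dest: fun_cong[of _ _ i])
  qed
  ultimately show ?thesis by (blast intro: finite_imageD inj_on_subset)
qed

lemma bounded_snap_image: assumes "bounded B" shows "bounded (snap n ` (B::'a::euclidean_space set))"
proof -
  from assms obtain r where r: "\<And>x. x \<in> B \<Longrightarrow> norm x \<le> r" by (auto simp: bounded_iff)
  have "norm (snap n x) \<le> (\<Sum>i\<in>(Basis::'a set). 2 ^ n * r + 1)" if x: "x \<in> B" for x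
  proof (rule order_trans[OF norm_le_l1 sum_mono])
    fix i :: 'a assume i: "i \<in> Basis"
    have "\<bar>x \<bullet> i\<bar> \<le> r" using Basis_le_norm[OF i, of x] r[OF x] by simp
    then have "\<bar>2 ^ n * (x \<bullet> i)\<bar> \<le> 2 ^ n * r" by (simp add: abs_mult)
    then show "\<bar>snap n x \<bullet> i\<bar> \<le> 2 ^ n * r + 1" unfolding snap_inner[OF i] by linarith
  qed
  then show ?thesis by (auto simp: bounded_iff)
qed

lemma finite_snap_image: "bounded B \<Longrightarrow> finite (snap n ` (B::'a::euclidean_space set))"
  by (rule finite_subset[OF _ finite_integral_points[OF bounded_snap_image]]) (auto intro: snap_integral)

lemma finite_window: "finite (window n :: 'a::euclidean_space set)"
proof -
  have "bounded (window n :: 'a set)"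
    unfolding bounded_iff
  proof (intro exI ballI)
    fix z :: 'a assume "z \<in> window n"
    then have "(\<Sum>i\<in>Basis. \<bar>z \<bullet> i\<bar>) \<le> (\<Sum>i\<in>(Basis::'a set). real n * 2 ^ n)"
      by (intro sum_mono) (auto simp: window_def)
    then show "norm z \<le> (\<Sum>i\<in>(Basis::'a set). real n * 2 ^ n)"
      using norm_le_l1[of z] by linarith
  qed
  then show ?thesis
    by (rule finite_subset[OF _ finite_integral_points, rotated]) (auto simp: window_def)
qed

lemma snap_in_window:
  assumes "norm x \<le> real n" shows "snap n x \<in> window n"
proof -
  have "\<bar>of_int \<lfloor>2 ^ n * (x \<bullet> i)\<rfloor>\<bar> \<le> real n * 2 ^ n" if i: "i \<in> Basis" for i
  proof -
    have "\<bar>x \<bullet> i\<bar> \<le> real n" using Basis_le_norm[OF i, of x] assms by simp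
    then have "\<bar>2 ^ n * (x \<bullet> i)\<bar> \<le> of_int (int n * 2 ^ n)" by (simp add: abs_mult mult.commute)
    then have "\<bar>\<lfloor>2 ^ n * (x \<bullet> i)\<rfloor>\<bar> \<le> int n * 2 ^ n" by linarith
    then have "of_int \<bar>\<lfloor>2 ^ n * (x \<bullet> i)\<rfloor>\<bar> \<le> (of_int (int n * 2 ^ n) :: real)" by (rule of_int_le_iff[THEN iffD2])
    then show ?thesis by simp
  qed
  then show ?thesis by (simp add: window_def snap_integral snap_inner)
qed

lemma snap_window_Suc:
  assumes "snap n x \<in> window n" shows "snap (Suc n) x \<in> window (Suc n)"
proof -
  have "\<bar>of_int \<lfloor>2 ^ Suc n * (x \<bullet> i)\<rfloor>\<bar> \<le> real (Suc n) * 2 ^ Suc n" if i: "i \<in> Basis" for i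
  proof -
    define a where "a = 2 ^ n * (x \<bullet> i)"
    define N :: int where "N = int n * 2 ^ n"
    have "real_of_int \<bar>\<lfloor>a\<rfloor>\<bar> \<le> of_int N"
      using assms i by (auto simp: window_def snap_inner a_def N_def)
    then have "\<bar>\<lfloor>a\<rfloor>\<bar> \<le> N" by (rule of_int_le_iff[THEN iffD1])
    \<comment> \<open>The floor of \<open>2 * a\<close> exceeds twice the floor of \<open>a\<close>
      by at most 1; the next window has a margin of \<open>2 ^ Suc n\<close>, which is at least
      2.\<close>
    then have "\<bar>\<lfloor>2 * a\<rfloor>\<bar> \<le> 2 * N + 2" by linarith
    also have "\<dots> \<le> (int n + 1) * 2 ^ Suc n" by (simp add: N_def algebra_simps)
    finally have "of_int \<bar>\<lfloor>2 * a\<rfloor>\<bar> \<le> (of_int ((int n + 1) * 2 ^ Suc n) :: real)" by (rule of_int_le_iff[THEN iffD2])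
    moreover have eq: "2 ^ Suc n * (x \<bullet> i) = 2 * a" by (simp add: a_def)
    ultimately show ?thesis unfolding eq by (simp add: add.commute)
  qed
  then show ?thesis by (simp add: window_def snap_integral snap_inner del: power_Suc)
qed

lemma card_cell_refine:
  assumes "loc_finite L" "n \<le> m"
  shows "card (L \<inter> cell n z) = (\<Sum>w\<in>snap m ` cell n z. card (L \<inter> cell m w))"
proof -
  have "L \<inter> cell n z = (\<Union>w\<in>snap m ` cell n z. L \<inter> cell m w)"
    using snap_coarsen[OF assms(2)] by (fastforce simp: cell_def)
  moreover have "card (\<Union>w\<in>snap m ` cell n z. L \<inter> cell m w) = (\<Sum>w\<in>snap m ` cell n z. card (L \<inter> cell m w))"
  proof (rule card_UN_disjoint)
    show "finite (snap m ` cell n z)" by (rule finite_snap_image[OF bounded_cell])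
    show "\<forall>w\<in>snap m ` cell n z. finite (L \<inter> cell m w)"
      using assms(1) bounded_cell by (auto simp: loc_finite_def)
    show "\<forall>v\<in>snap m ` cell n z. \<forall>w\<in>snap m ` cell n z. v \<noteq> w \<longrightarrow> L \<inter> cell m v \<inter> (L \<inter> cell m w) = {}"
      using cell_disjoint by blast
  qed
  ultimately show ?thesis by simp
qed

section \<open>Insertion of points\<close>

definition undesired :: "real \<Rightarrow> 'a::metric_space set \<Rightarrow> 'a \<Rightarrow> bool" where
  "undesired R L x \<longleftrightarrow> x \<in> L \<and> (\<forall>u\<in>L. u \<noteq> x \<and> dist u x < R \<longrightarrow> closer_matched L u x)"

text \<open>As \<open>x\<close> is undesired, \<open>y\<close> has a partner \<open>v\<close> closer
  than \<open>x\<close>; as \<open>y\<close> is undesired, \<open>v\<close> must have a partner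
  closer than \<open>y\<close>, although its only partner is \<open>y\<close>.\<close>

lemma undesired_separated:
  assumes x: "undesired R L x" and y: "undesired R L y" and d: "dist x y < R"
  shows "x = y"
proof (rule ccontr)
  assume "x \<noteq> y"
  then obtain v where v: "matched L y v" "dist y v < dist y x"
    using x y d by (auto simp: undesired_def closer_matched_def dist_commute)
  then have "closer_matched L v y"
    using matched_in[OF v(1)] y d by (auto simp: undesired_def dist_commute)
  then show False
    using matched_unique[OF matched_sym[OF v(1)]] by (auto simp: closer_matched_def dist_commute)
qed

lemma loc_finite_gap:
  assumes "loc_finite L"
  shows "\<exists>e>0. \<forall>u\<in>L. u \<noteq> t \<longrightarrow> e < dist t u"
proof -
  have "finite (L \<inter> cball t 1)" using assms by (auto simp: loc_finite_def)
  from finite_set_avoid[OF this, of t] obtain d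
    where d: "d > 0" "\<And>u. u \<in> L \<inter> cball t 1 \<Longrightarrow> u \<noteq> t \<Longrightarrow> d \<le> dist t u" by blast
  show ?thesis
  proof (intro exI[of _ "min d 1 / 2"] conjI ballI impI)
    fix u assume "u \<in> L" "u \<noteq> t"
    then show "min d 1 / 2 < dist t u" using d(1) d(2)[of u] by (cases "dist t u \<le> 1") auto
  qed (use d in auto)
qed

text \<open>All points of the cell are tested because level \<open>n\<close> may be coarser than
  \<open>m\<close>; a cell that meets an \<open>A\<close>-cell only partly is left out too.\<close>

definition outer :: "nat \<Rightarrow> 'a::euclidean_space set \<Rightarrow> nat \<Rightarrow> 'a set" where
  "outer m A n = {z \<in> window n. \<forall>u\<in>cell n z. snap m u \<notin> A}"

text \<open>
  Outside the cells with index in \<open>A\<close> (at level \<open>m\<close>), \<open>L'\<close> looks like \<open>L\<close> at resolution \<open>n\<close> in a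
  large window; it has two points in each of these cells. Nothing is required
  outside the window, so that the notion depends on finitely many counts.
\<close>

definition modification ::
    "nat \<Rightarrow> 'a::euclidean_space set \<Rightarrow> nat \<Rightarrow> 'a set \<Rightarrow> 'a set \<Rightarrow> bool" where
  "modification m A n L L' \<longleftrightarrow> loc_finite L' \<and>
     (\<forall>z\<in>outer m A n. card (L' \<inter> cell n z) = card (L \<inter> cell n z)) \<and>
     (\<forall>a\<in>A. card (L' \<inter> cell m a) = 2)"

lemma finite_cell: "loc_finite L \<Longrightarrow> finite (L \<inter> cell n z)"
  by (simp add: loc_finite_def bounded_cell)

lemma modificationD:
  assumes "modification m A n L L'"
  shows "loc_finite L'" "z \<in> outer m A n \<Longrightarrow> card (L' \<inter> cell n z) = card (L \<inter> cell n z)"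
    "a \<in> A \<Longrightarrow> card (L' \<inter> cell m a) = 2"
  using assms by (simp_all add: modification_def)

section \<open>Persistence of the matching under modifications\<close>

locale undesired_beyond =
  fixes L :: "'a::euclidean_space set" and x :: 'a and c :: real
  assumes lf: "loc_finite L" and xL: "x \<in> L"
    and far: "\<And>y. y \<in> L \<Longrightarrow> dist y x > c \<Longrightarrow> closer_matched L y x"
begin

definition "D = {y \<in> L. y \<noteq> x \<and> \<not> closer_matched L y x}"
text \<open>The points that will receive a companion. A partner of \<open>x\<close> desires
  \<open>x\<close>, so it lies in \<open>D\<close> and is diverted to its companion;
  \<open>x\<close> is left out of \<open>T\<close> so that it stays alone.\<close>

definition "T = (D \<union> {v. \<exists>y\<in>D. matched L y v}) - {x}"

lemma finite_ball: "finite {u \<in> L. dist u a \<le> r}"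
proof -
  have "{u \<in> L. dist u a \<le> r} = L \<inter> cball a r" by (auto simp: dist_commute)
  then show ?thesis using lf by (simp add: loc_finite_def)
qed

lemma finite_T: "finite T"
proof -
  have "D \<subseteq> {u \<in> L. dist u x \<le> c}" using far by (auto simp: D_def not_less[symmetric])
  then have D: "finite D" using finite_ball by (rule finite_subset)
  moreover have "{v. \<exists>y\<in>D. matched L y v} \<subseteq> (\<lambda>y. SOME v. matched L y v) ` D"
  proof safe
    fix y v assume y: "y \<in> D" and v: "matched L y v"
    have "matched L y (SOME v. matched L y v)" using v by (rule someI)
    then have "v = (SOME v. matched L y v)" using v by (rule matched_unique)
    then show "v \<in> (\<lambda>y. SOME v. matched L y v) ` D" using y by (rule image_eqI)
  qed
  then have "finite {v. \<exists>y\<in>D. matched L y v}" by (rule finite_subset) (simp add: D)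
  ultimately show ?thesis by (simp add: T_def)
qed

lemma T_in: "T \<subseteq> L" "x \<notin> T"
  by (auto simp: T_def D_def dest: matched_in)

text \<open>The complement of \<open>T\<close> and \<open>x\<close> is closed under taking partners:
  a point there does not desire \<open>x\<close>, and a partner in \<open>T\<close> would by
  uniqueness put the point itself into \<open>T\<close>.\<close>

lemma outside_T:
  assumes uv: "matched L u v" and u: "u \<notin> T" "u \<noteq> x"
  shows "v \<notin> T" "v \<noteq> x" "dist u v < dist u x"
proof -
  have "u \<notin> D" using u by (auto simp: T_def)
  then have "closer_matched L u x" using matched_in[OF uv] u by (auto simp: D_def)
  then show d: "dist u v < dist u x" using matched_unique[OF uv] by (auto simp: closer_matched_def)
  show "v \<noteq> x" using d by auto
  show "v \<notin> T"
  proof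
    assume "v \<in> T"
    then consider "v \<in> D" | y where "y \<in> D" "matched L y v" by (auto simp: T_def)
    then show False
    proof cases
      case 1
      then show False using u matched_sym[OF uv] by (auto simp: T_def)
    next
      case (2 y)
      then have "y = u" using matched_unique[OF matched_sym[OF uv] matched_sym] by simp
      then show False using 2 \<open>u \<notin> D\<close> by simp
    qed
  qed
qed

text \<open>\<open>T\<close> is finite and each of its points is isolated in \<open>L\<close>. The
  factor 4 absorbs several displacements by one mesh each in the triangle inequalities that
  follow.\<close>

lemma ex_scale: "\<exists>m. \<forall>t\<in>T. \<forall>u\<in>L. u \<noteq> t \<longrightarrow> 4 * mesh TYPE('a) m < dist t u"
proof -
  have "\<forall>t\<in>T. \<forall>\<^sub>F m in sequentially. \<forall>u\<in>L. u \<noteq> t \<longrightarrow> 4 * mesh TYPE('a) m < dist t u"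
  proof
    fix t
    obtain e where e: "e > 0" "\<And>u. u \<in> L \<Longrightarrow> u \<noteq> t \<Longrightarrow> e < dist t u"
      using loc_finite_gap[OF lf, of t] by blast
    show "\<forall>\<^sub>F m in sequentially. \<forall>u\<in>L. u \<noteq> t \<longrightarrow> 4 * mesh TYPE('a) m < dist t u"
      using eventually_mesh_less[OF e(1), of 4, where 'a = 'a] by eventually_elim (use e(2) in fastforce)
  qed
  then have "\<forall>\<^sub>F m in sequentially. \<forall>t\<in>T. \<forall>u\<in>L. u \<noteq> t \<longrightarrow> 4 * mesh TYPE('a) m < dist t u"
    by (rule eventually_ball_finite[OF finite_T])
  then show ?thesis by (auto simp: eventually_sequentially)
qed

end

locale undesired_beyond_scale = undesired_beyond +
  fixes m :: nat
  assumes gap: "\<And>t u. t \<in> T \<Longrightarrow> u \<in> L \<Longrightarrow> u \<noteq> t \<Longrightarrow> 4 * mesh TYPE('a) m < dist t u"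
begin

abbreviation "mod_at \<equiv> modification m (snap m ` T)"

lemma snap_T:
  assumes "u \<in> L - T" shows "snap m u \<notin> snap m ` T"
proof
  assume "snap m u \<in> snap m ` T"
  then obtain t where t: "t \<in> T" "snap m t = snap m u" by auto
  then show False using gap[of t u] snap_dist[OF t(2)] assms mesh_pos[where 'a = 'a, of m] by auto
qed

lemma outer_cell:
  assumes "n \<ge> m" "norm u \<le> real n" "snap m u \<notin> snap m ` T"
  shows "snap n u \<in> outer m (snap m ` T) n"
proof -
  have "snap m y \<notin> snap m ` T" if "y \<in> cell n (snap n u)" for y
  proof -
    have "snap n y = snap n u" using that by (simp add: cell_def)
    then show ?thesis using snap_coarsen[OF assms(1), of y u] assms(3) by simp
  qed
  then show ?thesis using snap_in_window[OF assms(2)] by (simp add: outer_def)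
qed

text \<open>A point of \<open>L'\<close> makes the count of its cell positive, and equality of the
  counts carries this back to \<open>L\<close>; \<open>mod_forth\<close> is the converse
  transfer.\<close>

lemma mod_back:
  assumes "mod_at n L L'" "n \<ge> m" "norm w' \<le> real n" "w' \<in> L'" "snap m w' \<notin> snap m ` T"
  obtains w where "w \<in> L - T" "snap n w = snap n w'"
proof -
  have "finite (L' \<inter> cell n (snap n w'))"
    by (intro finite_cell modificationD(1)[OF assms(1)])
  moreover have "w' \<in> L' \<inter> cell n (snap n w')" using assms by (simp add: cell_def)
  ultimately have "card (L' \<inter> cell n (snap n w')) > 0" by (auto simp: card_gt_0_iff)
  then have "card (L \<inter> cell n (snap n w')) > 0"
    by (simp only: modificationD(2)[OF assms(1) outer_cell[OF assms(2,3,5)]])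
  then obtain w where w: "w \<in> L" "snap n w = snap n w'"
    by (auto simp: card_gt_0_iff cell_def)
  have "snap m w = snap m w'" by (rule snap_coarsen[OF assms(2) w(2)])
  then have "w \<notin> T" using assms(5) imageI[of w T "snap m"] by argo
  then show thesis using w that by blast
qed

lemma mod_forth:
  assumes "mod_at n L L'" "n \<ge> m" "norm w \<le> real n" "w \<in> L - T"
  obtains w' where "w' \<in> L'" "snap n w' = snap n w"
proof -
  have "finite (L \<inter> cell n (snap n w))" by (rule finite_cell[OF lf])
  moreover have "w \<in> L \<inter> cell n (snap n w)" using assms by (simp add: cell_def)
  ultimately have "card (L \<inter> cell n (snap n w)) > 0" by (auto simp: card_gt_0_iff)
  then have "card (L' \<inter> cell n (snap n w)) > 0"
    by (simp only: modificationD(2)[OF assms(1) outer_cell[OF assms(2,3) snap_T[OF assms(4)]]])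
  then show thesis using that by (auto simp: card_gt_0_iff cell_def)
qed

text \<open>At fine levels \<open>u\<close> is alone in its cell, so the prescribed count is
  1.\<close>

lemma mod_unique:
  assumes u: "u \<in> L - T"
  shows "\<forall>\<^sub>F n in sequentially. \<forall>L'. mod_at n L L' \<longrightarrow>
    (\<forall>a\<in>L'. \<forall>b\<in>L'. snap n a = snap n u \<longrightarrow> snap n b = snap n u \<longrightarrow> a = b)"
proof -
  obtain e where e: "e > 0" "\<And>v. v \<in> L \<Longrightarrow> v \<noteq> u \<Longrightarrow> e < dist u v"
    using loc_finite_gap[OF lf, of u] by blast
  obtain k where k: "norm u \<le> real k" using real_arch_simple by blast
  show ?thesis
    using eventually_mesh_less[OF e(1), of 1, where 'a = 'a] eventually_ge_at_top[of m] eventually_ge_at_top[of k]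
  proof eventually_elim
    case (elim n)
    have "v = u" if "v \<in> L" "snap n v = snap n u" for v
      using e(2)[OF that(1)] snap_dist[OF that(2)] elim(1) by (auto simp: dist_commute)
    then have "L \<inter> cell n (snap n u) = {u}" using u by (auto simp: cell_def)
    moreover have "norm u \<le> real n" using k elim(3) by simp
    ultimately have "card (L' \<inter> cell n (snap n u)) = 1" if "mod_at n L L'" for L'
      using modificationD(2)[OF that outer_cell[OF elim(2) _ snap_T[OF u]]] by simp
    then have "\<exists>a. L' \<inter> cell n (snap n u) = {a}" if "mod_at n L L'" for L'
      using that by (simp add: card_1_singleton_iff)
    note single = this
    show ?case
    proof (intro allI impI ballI)
      fix L' a b assume "mod_at n L L'" "a \<in> L'" "b \<in> L'" "snap n a = snap n u" "snap n b = snap n u"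
      moreover from this obtain c where "L' \<inter> cell n (snap n u) = {c}" using single by auto
      ultimately have "a \<in> {c}" "b \<in> {c}" by (auto simp: cell_def)
      then show "a = b" by simp
    qed
  qed
qed

text \<open>The premise of the matching rule holds vacuously: a competitor in \<open>L'\<close>
  would lie near some point of \<open>L\<close> other than \<open>t\<close> that is within three
  meshes of \<open>t\<close>, against \<open>gap\<close>.\<close>

lemma mod_pair:
  "\<forall>\<^sub>F n in sequentially. \<forall>L'. mod_at n L L' \<longrightarrow>
    (\<forall>t\<in>T. \<forall>b\<in>L'. \<forall>b'\<in>L'. snap m b = snap m t \<longrightarrow> snap m b' = snap m t \<longrightarrow> b \<noteq> b' \<longrightarrow> matched L' b b')"
proof -
  have "\<forall>t\<in>T. \<forall>\<^sub>F n in sequentially. norm t + 2 * mesh TYPE('a) m \<le> real n"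
    by (simp add: eventually_nat_real)
  then have "\<forall>\<^sub>F n in sequentially. \<forall>t\<in>T. norm t + 2 * mesh TYPE('a) m \<le> real n"
    by (rule eventually_ball_finite[OF finite_T])
  then show ?thesis using eventually_ge_at_top[of m]
  proof (eventually_elim, safe)
    fix n L' t b b'
    assume n: "\<forall>t\<in>T. norm t + 2 * mesh TYPE('a) m \<le> real n" "m \<le> n" and L': "mod_at n L L'" and t: "t \<in> T"
      and b: "b \<in> L'" "b' \<in> L'" "snap m b = snap m t" "snap m b' = snap m t" "b \<noteq> b'"
    have bt: "dist b t \<le> mesh TYPE('a) m" "dist b' t \<le> mesh TYPE('a) m" "dist b b' \<le> mesh TYPE('a) m" using b by (auto intro: snap_dist)
    have two: "w \<in> {b, b'}" if "w \<in> L'" "snap m w = snap m t" for w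
    proof -
      have "card (L' \<inter> cell m (snap m t)) = 2" by (rule modificationD(3)[OF L' imageI[OF t]])
      moreover have "{b, b'} \<subseteq> L' \<inter> cell m (snap m t)" using b by (auto simp: cell_def)
      moreover have "card {b, b'} = 2" using b by simp
      ultimately have "{b, b'} = L' \<inter> cell m (snap m t)"
        by (intro card_subset_eq card_ge_0_finite) auto
      then show ?thesis using that by (auto simp: cell_def)
    qed
    show "matched L' b b'"
    proof (intro matchedI b ballI impI)
      fix w y assume w: "w \<in> L' - {b, b'}" and y: "y \<in> {b, b'}" and "dist w y \<le> dist b b'"
      then have wy: "dist w y \<le> mesh TYPE('a) m" "dist y t \<le> mesh TYPE('a) m" using bt by auto
      then have wt: "dist w t \<le> 2 * mesh TYPE('a) m" using dist_triangle[of w t y] by simp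
      \<comment> \<open>If \<open>w\<close> lies in a cell of \<open>T\<close>, it is the cell of
        another point, since \<open>b\<close> and \<open>b'\<close> exhaust that of
        \<open>t\<close>; otherwise \<open>w\<close> traces back to a point of \<open>L\<close> at
        level \<open>n\<close>.\<close>
      have "\<exists>u\<in>L. u \<noteq> t \<and> dist u w \<le> mesh TYPE('a) m"
      proof (cases "snap m w \<in> snap m ` T")
        case True
        then obtain s where s: "snap m w = snap m s" "s \<in> T" by (rule imageE)
        then have "s \<noteq> t" using two w by auto
        then show ?thesis using s T_in by (auto intro!: bexI[of _ s] snap_dist)
      next
        case False
        have "norm w \<le> real n"
          using n t wt norm_triangle_ineq[of "w - t" t] by (fastforce simp: dist_norm)
        then obtain u where u: "u \<in> L - T" "snap n u = snap n w"
          using mod_back[OF L' n(2) _ _ False] w by auto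
        then have "dist u w \<le> mesh TYPE('a) m" using snap_dist[OF u(2)] mesh_antimono[OF n(2), where 'a = 'a] by simp
        then show ?thesis using u t by auto
      qed
      then obtain u where "u \<in> L" "u \<noteq> t" "dist u w \<le> mesh TYPE('a) m" by auto
      then show "\<exists>v. matched L' w v \<and> dist w v < dist w y"
        using gap[of t u] t wt dist_triangle[of t u w] mesh_pos[where 'a = 'a, of m]
        by (auto simp: dist_commute)
    qed
  qed
qed

text \<open>The level is chosen before \<open>L'\<close>: it must work for all modifications at
  once, so that the conclusion follows from the counts alone.\<close>

definition persists :: "'a \<Rightarrow> 'a \<Rightarrow> bool" where
  "persists w u \<longleftrightarrow> (\<forall>\<^sub>F n in sequentially. \<forall>L'. mod_at n L L' \<longrightarrow>
     (\<forall>w'\<in>L'. \<forall>u'\<in>L'. snap n w' = snap n w \<longrightarrow> snap n u' = snap n u \<longrightarrow> closer_matched L' w' u'))"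

definition copied :: "'a \<Rightarrow> 'a \<Rightarrow> bool" where
  "copied u v \<longleftrightarrow> (\<forall>\<^sub>F n in sequentially. \<forall>L'. mod_at n L L' \<longrightarrow>
     (\<forall>u'\<in>L'. \<forall>v'\<in>L'. snap n u' = snap n u \<longrightarrow> snap n v' = snap n v \<longrightarrow> matched L' u' v'))"

text \<open>The strict inequality survives at fine levels: each of the two distances changes by at
  most two meshes, four in total. Membership of \<open>z\<close> in \<open>L - T\<close> provides
  its copy in \<open>L'\<close>.\<close>

lemma persistsI:
  assumes "copied w z" "dist w z < dist w u" "z \<in> L - T"
  shows "persists w u"
proof -
  obtain k where k: "norm z \<le> real k" using real_arch_simple by blast
  have "4 * mesh TYPE('a) n < dist w u - dist w z \<Longrightarrow> snap n w' = snap n w \<Longrightarrow> snap n u' = snap n u \<Longrightarrow>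
      snap n z' = snap n z \<Longrightarrow> dist w' z' < dist w' u'" for n w' u' z'
    using snap_dist[of n w' w] snap_dist[of n u' u] snap_dist[of n z' z]
      dist_triangle[of w u w'] dist_triangle[of w' u u'] dist_triangle[of w' z' w] dist_triangle[of w z' z]
    by (simp add: dist_commute)
  note close = this
  have pos: "dist w u - dist w z > 0" using assms by simp
  show ?thesis
    unfolding persists_def
    using assms(1)[unfolded copied_def] eventually_mesh_less[OF pos, of 4, where 'a = 'a]
      eventually_ge_at_top[of m] eventually_ge_at_top[of k]
  proof (eventually_elim, safe)
    fix n L' w' u'
    assume n: "\<forall>L'. mod_at n L L' \<longrightarrow> (\<forall>u'\<in>L'. \<forall>v'\<in>L'. snap n u' = snap n w \<longrightarrow> snap n v' = snap n z \<longrightarrow> matched L' u' v')"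
      "4 * mesh TYPE('a) n < dist w u - dist w z" "m \<le> n" "k \<le> n"
      and L': "mod_at n L L'" and w': "w' \<in> L'" "u' \<in> L'" "snap n w' = snap n w" "snap n u' = snap n u"
    have "norm z \<le> real n" using k n(4) by simp
    then obtain z' where z': "z' \<in> L'" "snap n z' = snap n z"
      using mod_forth[OF L' n(3) _ assms(3)] by blast
    then have "matched L' w' z'" using n(1) L' w' by blast
    then show "closer_matched L' w' u'"
      using close[OF n(2) w'(3,4) z'(2)] by (auto simp: closer_matched_def)
  qed
qed

text \<open>No new competitor appears near a copy of \<open>u\<close>. A point of \<open>L'\<close>
  in a cell of \<open>T\<close> is matched to its companion; any other one is a copy of a point of
  \<open>L - T\<close>, which at fine levels is itself within \<rho> of \<open>u\<close>. The cell
  of \<open>v\<close> is exempt, for the prospective partner.\<close>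

lemma persists_near:
  assumes u: "u \<in> L - T" and near: "\<And>w. w \<in> L - T \<Longrightarrow> w \<noteq> u \<Longrightarrow> w \<noteq> v \<Longrightarrow> dist w u \<le> \<rho> \<Longrightarrow> persists w u"
  shows "\<forall>\<^sub>F n in sequentially. \<forall>L'. mod_at n L L' \<longrightarrow>
    (\<forall>u'\<in>L'. \<forall>w'\<in>L'. snap n u' = snap n u \<longrightarrow> w' \<noteq> u' \<longrightarrow> snap n w' \<noteq> snap n v \<longrightarrow>
       dist w' u' \<le> \<rho> + 2 * mesh TYPE('a) n \<longrightarrow> closer_matched L' w' u')"
proof -
  \<comment> \<open>Finitely many points can have copies in range; those farther than \<rho> are
    eventually kept out by a margin of four meshes, which covers the slack of two in the claim and
    the displacements of \<open>u'\<close> and \<open>w'\<close>.\<close>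
  define F where "F = {w \<in> L. dist w u \<le> \<rho> + 4 * mesh TYPE('a) m}"
  have F: "finite F" unfolding F_def by (rule finite_ball)
  have "\<forall>w\<in>F. \<forall>\<^sub>F n in sequentially. \<rho> < dist w u \<longrightarrow> \<rho> + 4 * mesh TYPE('a) n < dist w u"
  proof
    fix w
    show "\<forall>\<^sub>F n in sequentially. \<rho> < dist w u \<longrightarrow> \<rho> + 4 * mesh TYPE('a) n < dist w u"
    proof (cases "\<rho> < dist w u")
      case True
      then have "dist w u - \<rho> > 0" by simp
      from eventually_mesh_less[OF this, of 4, where 'a = 'a] show ?thesis by eventually_elim auto
    qed simp
  qed
  then have 1: "\<forall>\<^sub>F n in sequentially. \<forall>w\<in>F. \<rho> < dist w u \<longrightarrow> \<rho> + 4 * mesh TYPE('a) n < dist w u"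
    by (rule eventually_ball_finite[OF F])
  have "\<forall>w\<in>F. \<forall>\<^sub>F n in sequentially. w \<in> L - T \<and> w \<noteq> u \<and> w \<noteq> v \<and> dist w u \<le> \<rho> \<longrightarrow> (\<forall>L'. mod_at n L L' \<longrightarrow>
     (\<forall>w'\<in>L'. \<forall>u'\<in>L'. snap n w' = snap n w \<longrightarrow> snap n u' = snap n u \<longrightarrow> closer_matched L' w' u'))"
  proof
    fix w
    show "\<forall>\<^sub>F n in sequentially. w \<in> L - T \<and> w \<noteq> u \<and> w \<noteq> v \<and> dist w u \<le> \<rho> \<longrightarrow> (\<forall>L'. mod_at n L L' \<longrightarrow>
     (\<forall>w'\<in>L'. \<forall>u'\<in>L'. snap n w' = snap n w \<longrightarrow> snap n u' = snap n u \<longrightarrow> closer_matched L' w' u'))"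
      using near[of w] by (cases "w \<in> L - T \<and> w \<noteq> u \<and> w \<noteq> v \<and> dist w u \<le> \<rho>") (auto simp: persists_def)
  qed
  then have 2: "\<forall>\<^sub>F n in sequentially. \<forall>w\<in>F. w \<in> L - T \<and> w \<noteq> u \<and> w \<noteq> v \<and> dist w u \<le> \<rho> \<longrightarrow> (\<forall>L'. mod_at n L L' \<longrightarrow>
     (\<forall>w'\<in>L'. \<forall>u'\<in>L'. snap n w' = snap n w \<longrightarrow> snap n u' = snap n u \<longrightarrow> closer_matched L' w' u'))"
    by (rule eventually_ball_finite[OF F])
  have 3: "\<forall>\<^sub>F n in sequentially. norm u + \<rho> + 4 * mesh TYPE('a) m \<le> real n" by (simp add: eventually_nat_real)
  show ?thesis
    using 1 2 3 mod_unique[OF u] mod_pair eventually_ge_at_top[of m]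
  proof (eventually_elim, safe)
    fix n L' u' w'
    assume n1: "\<forall>w\<in>F. \<rho> < dist w u \<longrightarrow> \<rho> + 4 * mesh TYPE('a) n < dist w u"
      and n2: "\<forall>w\<in>F. w \<in> L - T \<and> w \<noteq> u \<and> w \<noteq> v \<and> dist w u \<le> \<rho> \<longrightarrow> (\<forall>L'. mod_at n L L' \<longrightarrow>
         (\<forall>w'\<in>L'. \<forall>u'\<in>L'. snap n w' = snap n w \<longrightarrow> snap n u' = snap n u \<longrightarrow> closer_matched L' w' u'))"
      and n3: "norm u + \<rho> + 4 * mesh TYPE('a) m \<le> real n"
      and n4: "\<forall>L'. mod_at n L L' \<longrightarrow> (\<forall>a\<in>L'. \<forall>b\<in>L'. snap n a = snap n u \<longrightarrow> snap n b = snap n u \<longrightarrow> a = b)"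
      and n5: "\<forall>L'. mod_at n L L' \<longrightarrow> (\<forall>t\<in>T. \<forall>b\<in>L'. \<forall>b'\<in>L'. snap m b = snap m t \<longrightarrow>
         snap m b' = snap m t \<longrightarrow> b \<noteq> b' \<longrightarrow> matched L' b b')"
      and n6: "m \<le> n" and L': "mod_at n L L'" and w': "u' \<in> L'" "w' \<in> L'" "snap n u' = snap n u" "w' \<noteq> u'"
        "snap n w' \<noteq> snap n v" "dist w' u' \<le> \<rho> + 2 * mesh TYPE('a) n"
    have uu: "dist u' u \<le> mesh TYPE('a) n" using w' by (intro snap_dist)
    have small: "mesh TYPE('a) n \<le> mesh TYPE('a) m" "mesh TYPE('a) m > 0" using mesh_antimono[OF n6, where 'a = 'a] mesh_pos[where 'a = 'a] by auto
    show "closer_matched L' w' u'"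
    \<comment> \<open>In a cell of \<open>T\<close> the companion is within one mesh of
      \<open>w'\<close>, whereas \<open>u'\<close> is farther than two meshes because of
      \<open>gap\<close>.\<close>
    proof (cases "snap m w' \<in> snap m ` T")
      case True
      then obtain t where t: "t \<in> T" "snap m w' = snap m t" by auto
      have "card (L' \<inter> cell m (snap m t)) = 2" by (rule modificationD(3)[OF L' imageI[OF t(1)]])
      then obtain p q where "L' \<inter> cell m (snap m t) = {p, q}" "p \<noteq> q" by (auto simp: card_2_iff)
      moreover have "w' \<in> L' \<inter> cell m (snap m t)" using w' t by (auto simp: cell_def)
      ultimately obtain w'' where "w'' \<in> L' \<inter> cell m (snap m t)" "w'' \<noteq> w'" by blast
      then have w'': "w'' \<in> L'" "snap m w'' = snap m t" "w'' \<noteq> w'" by (auto simp: cell_def)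
      then have "matched L' w' w''" using n5 L' t w' by auto
      moreover have "dist w' w'' < dist w' u'"
      proof -
        have "4 * mesh TYPE('a) m < dist t u" using gap[OF t(1), of u] u t by auto
        moreover have "dist t w' \<le> mesh TYPE('a) m" "dist w' w'' \<le> mesh TYPE('a) m" using t w'' by (auto intro: snap_dist)
        ultimately show ?thesis
          using uu small dist_triangle[of t u w'] dist_triangle[of w' u u'] by auto
      qed
      ultimately show ?thesis by (auto simp: closer_matched_def)
    next
      case False
      have "dist w' u \<le> \<rho> + 3 * mesh TYPE('a) n" using w' uu dist_triangle[of w' u u'] by simp
      moreover have "norm w' \<le> dist w' u + norm u" using norm_triangle_ineq[of "w' - u" u] by (simp add: dist_norm)
      ultimately have "norm w' \<le> real n" using n3 small by simp
      then obtain w where w: "w \<in> L - T" "snap n w = snap n w'"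
        using mod_back[OF L' n6 _ w'(2) False] by auto
      have wu: "w \<noteq> u" using n4 L' w' w by auto
      have wv: "w \<noteq> v" using w' w by auto
      have d: "dist w u \<le> \<rho> + 4 * mesh TYPE('a) n"
        using snap_dist[OF w(2)] \<open>dist w' u \<le> \<rho> + 3 * mesh TYPE('a) n\<close> dist_triangle[of w u w'] by simp
      then have "w \<in> F" using w small by (auto simp: F_def)
      then have "dist w u \<le> \<rho>" using n1 d by force
      then show ?thesis using n2 \<open>w \<in> F\<close> w wu wv L' w' by auto
    qed
  qed
qed

text \<open>Induction over the matching: all competitors of the pair have closer partners, whose
  pairs are copied by the induction hypothesis, so \<open>persists_near\<close> around both points
  yields the premise of the rule in \<open>L'\<close>.\<close>

lemma matched_copied:
  assumes "matched L u v" "u \<notin> T" "u \<noteq> x"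
  shows "copied u v"
  using assms
proof (induction rule: matched.induct)
  case (matchedI u v)
  have uv: "matched L u v"
    by (intro matched.intros matchedI.hyps ballI impI) (use matchedI.IH in blast)
  note v = outside_T[OF uv matchedI.prems]
  have vu: "matched L v u" by (rule matched_sym[OF uv])
  note u = outside_T[OF vu v(1,2)]
  have near: "persists w y" if w: "w \<in> L - T" "w \<noteq> u" "w \<noteq> v" "y \<in> {u, v}" "dist w y \<le> dist u v" for w y
  proof -
    obtain z where z: "matched L w z" "w \<notin> T \<Longrightarrow> w \<noteq> x \<Longrightarrow> copied w z" "dist w z < dist w y"
      using matchedI.IH w by blast
    \<comment> \<open>By \<open>outside_T\<close> both \<open>u\<close> and \<open>v\<close> are
      farther from \<open>x\<close> than from each other, so \<open>x\<close> does not compete with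
      the pair.\<close>
    have "w \<noteq> x" using w u(3) v(3) by (auto simp: dist_commute)
    then have "copied w z" "z \<notin> T" using z w outside_T[OF z(1)] by auto
    then show ?thesis using matched_in[OF z(1)] z by (auto intro: persistsI)
  qed
  have L: "u \<in> L - T" "v \<in> L - T" using matchedI v by auto
  have A: "\<forall>\<^sub>F n in sequentially. \<forall>L'. mod_at n L L' \<longrightarrow>
    (\<forall>u'\<in>L'. \<forall>w'\<in>L'. snap n u' = snap n u \<longrightarrow> w' \<noteq> u' \<longrightarrow> snap n w' \<noteq> snap n v \<longrightarrow>
       dist w' u' \<le> dist u v + 2 * mesh TYPE('a) n \<longrightarrow> closer_matched L' w' u')"
    by (rule persists_near[OF L(1)]) (use near in auto)
  have B: "\<forall>\<^sub>F n in sequentially. \<forall>L'. mod_at n L L' \<longrightarrow>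
    (\<forall>u'\<in>L'. \<forall>w'\<in>L'. snap n u' = snap n v \<longrightarrow> w' \<noteq> u' \<longrightarrow> snap n w' \<noteq> snap n u \<longrightarrow>
       dist w' u' \<le> dist u v + 2 * mesh TYPE('a) n \<longrightarrow> closer_matched L' w' u')"
    by (rule persists_near[OF L(2)]) (use near in auto)
  have pos: "dist u v > 0" using matchedI by simp
  show ?case
    unfolding copied_def
    using A B mod_unique[OF L(1)] mod_unique[OF L(2)] eventually_mesh_less[OF pos, of 1, where 'a = 'a]
  proof (eventually_elim, safe)
    fix n L' u' v'
    assume A: "\<forall>L'. mod_at n L L' \<longrightarrow>
    (\<forall>u'\<in>L'. \<forall>w'\<in>L'. snap n u' = snap n u \<longrightarrow> w' \<noteq> u' \<longrightarrow> snap n w' \<noteq> snap n v \<longrightarrow>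
       dist w' u' \<le> dist u v + 2 * mesh TYPE('a) n \<longrightarrow> closer_matched L' w' u')"
      and B: "\<forall>L'. mod_at n L L' \<longrightarrow>
    (\<forall>u'\<in>L'. \<forall>w'\<in>L'. snap n u' = snap n v \<longrightarrow> w' \<noteq> u' \<longrightarrow> snap n w' \<noteq> snap n u \<longrightarrow>
       dist w' u' \<le> dist u v + 2 * mesh TYPE('a) n \<longrightarrow> closer_matched L' w' u')"
      and U: "\<forall>L'. mod_at n L L' \<longrightarrow> (\<forall>a\<in>L'. \<forall>b\<in>L'. snap n a = snap n u \<longrightarrow> snap n b = snap n u \<longrightarrow> a = b)"
      and V: "\<forall>L'. mod_at n L L' \<longrightarrow> (\<forall>a\<in>L'. \<forall>b\<in>L'. snap n a = snap n v \<longrightarrow> snap n b = snap n v \<longrightarrow> a = b)"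
      and d: "1 * mesh TYPE('a) n < dist u v"
      and L': "mod_at n L L'" and u': "u' \<in> L'" "v' \<in> L'" "snap n u' = snap n u" "snap n v' = snap n v"
    have "snap n u \<noteq> snap n v" using snap_dist[of n u v] d by auto
    then have ne: "u' \<noteq> v'" using u' by auto
    have dd: "dist u' v' \<le> dist u v + 2 * mesh TYPE('a) n"
      using snap_dist[OF u'(3)] snap_dist[OF u'(4)] dist_triangle[of u' v' u] dist_triangle[of u v' v]
      by (simp add: dist_commute)
    show "matched L' u' v'"
    proof (intro matched.intros u' ne ballI impI)
      fix w y assume w: "w \<in> L' - {u', v'}" "y \<in> {u', v'}" "dist w y \<le> dist u' v'"
      then have "snap n w \<noteq> snap n u" "snap n w \<noteq> snap n v" using U V L' u' by blast+
      then have "closer_matched L' w y" using A B L' u' w dd by auto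
      then show "\<exists>v. matched L' w v \<and> dist w v < dist w y" by (simp add: closer_matched_def)
    qed
  qed
qed

lemma eventually_undesired:
  assumes "norm x < r"
  shows "\<forall>\<^sub>F n in sequentially. \<forall>L'. mod_at n L L' \<longrightarrow> (\<exists>x'\<in>L'. norm x' < r \<and> undesired R L' x')"
proof -
  have x: "x \<in> L - T" using xL T_in by auto
  have "persists w x" if w: "w \<in> L - T" "w \<noteq> x" for w
  proof -
    have "w \<notin> D" using w by (auto simp: T_def)
    then obtain z where z: "matched L w z" "dist w z < dist w x" using w by (auto simp: D_def closer_matched_def)
    then show ?thesis
      using w outside_T[OF z(1)] matched_copied[OF z(1)] matched_in[OF z(1)] by (auto intro: persistsI)
  qed
  \<comment> \<open>Here \<open>u\<close> and \<open>v\<close> are both \<open>x\<close>, so only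
    the cell of \<open>x\<close> is exempt, and \<rho> is the arbitrary radius
    \<open>R\<close>.\<close>
  then have A: "\<forall>\<^sub>F n in sequentially. \<forall>L'. mod_at n L L' \<longrightarrow>
    (\<forall>u'\<in>L'. \<forall>w'\<in>L'. snap n u' = snap n x \<longrightarrow> w' \<noteq> u' \<longrightarrow> snap n w' \<noteq> snap n x \<longrightarrow>
       dist w' u' \<le> R + 2 * mesh TYPE('a) n \<longrightarrow> closer_matched L' w' u')"
    by (intro persists_near[OF x])
  obtain k where k: "norm x \<le> real k" using real_arch_simple by blast
  have pos: "r - norm x > 0" using assms by simp
  show ?thesis
    using A mod_unique[OF x] eventually_mesh_less[OF pos, of 1, where 'a = 'a]
      eventually_ge_at_top[of m] eventually_ge_at_top[of k]
  proof (eventually_elim, safe)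
    fix n L'
    assume A: "\<forall>L'. mod_at n L L' \<longrightarrow>
    (\<forall>u'\<in>L'. \<forall>w'\<in>L'. snap n u' = snap n x \<longrightarrow> w' \<noteq> u' \<longrightarrow> snap n w' \<noteq> snap n x \<longrightarrow>
       dist w' u' \<le> R + 2 * mesh TYPE('a) n \<longrightarrow> closer_matched L' w' u')"
      and U: "\<forall>L'. mod_at n L L' \<longrightarrow> (\<forall>a\<in>L'. \<forall>b\<in>L'. snap n a = snap n x \<longrightarrow> snap n b = snap n x \<longrightarrow> a = b)"
      and n: "1 * mesh TYPE('a) n < r - norm x" "m \<le> n" "k \<le> n" and L': "mod_at n L L'"
    have "norm x \<le> real n" using k n(3) by simp
    then obtain x' where x': "x' \<in> L'" "snap n x' = snap n x" by (rule mod_forth[OF L' n(2) _ x])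
    have "norm x' < r"
      using snap_dist[OF x'(2)] norm_triangle_ineq[of "x' - x" x] n(1) by (simp add: dist_norm)
    moreover have "undesired R L' x'"
      unfolding undesired_def
    proof (intro conjI ballI impI x')
      fix u assume u: "u \<in> L'" "u \<noteq> x' \<and> dist u x' < R"
      then have "snap n u \<noteq> snap n x" using U L' x' by auto
      then show "closer_matched L' u x'" using A L' x' u mesh_pos[where 'a = 'a, of n] by auto
    qed
    ultimately show "\<exists>x'\<in>L'. norm x' < r \<and> undesired R L' x'" using x' by auto
  qed
qed

end

text \<open>It matters that \<open>m\<close> and \<open>A\<close> do not depend on \<open>R\<close>:
  there are only countably many choices of them, and the probability of two points in every
  \<open>A\<close>-cell is a factor independent of \<open>R\<close>.\<close>

lemma ex_modification_undesired:
  fixes L :: "'a::euclidean_space set"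
  assumes "loc_finite L" "x \<in> L" "\<And>y. y \<in> L \<Longrightarrow> dist y x > c \<Longrightarrow> closer_matched L y x" "norm x < r"
  shows "\<exists>m A. finite A \<and> A \<subseteq> integral_points \<and>
    (\<forall>R. \<exists>n. \<forall>L'. modification m A n L L' \<longrightarrow> (\<exists>x'\<in>L'. norm x' < r \<and> undesired R L' x'))"
proof -
  interpret undesired_beyond L x c by unfold_locales (use assms in auto)
  obtain m where m: "\<forall>t\<in>T. \<forall>u\<in>L. u \<noteq> t \<longrightarrow> 4 * mesh TYPE('a) m < dist t u" using ex_scale by auto
  interpret undesired_beyond_scale L x c m by unfold_locales (use m in auto)
  have "\<exists>n. \<forall>L'. mod_at n L L' \<longrightarrow> (\<exists>x'\<in>L'. norm x' < r \<and> undesired R L' x')" for R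
    using eventually_undesired[OF assms(4), of R] by (auto simp: eventually_sequentially)
  then show ?thesis
    using finite_T by (intro exI[of _ m] exI[of _ "snap m ` T"]) (auto intro: snap_integral)
qed

section \<open>Descending chains and shells\<close>

text \<open>Loop erasure: from the last visit to a value, proceed to the last visit to the value
  that comes next.\<close>

lemma loop_erasure:
  assumes fin: "\<And>z. finite {i::nat. q i = z}"
    and step: "\<And>i. q (Suc i) = q i \<or> q (Suc i) \<in> N (q i)"
  shows "\<exists>f. inj f \<and> range f \<subseteq> range q \<and> (\<forall>i. f (Suc i) \<in> N (f i))"
proof -
  define last where "last i = Max {j. q j = q i}" for i
  have last_mem: "last i \<in> {j. q j = q i}" for i
    unfolding last_def by (rule Max_in[OF fin]) auto
  then have q_last: "q (last i) = q i" for i by simp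
  have last_ge: "j \<le> last i" if "q j = q i" for i j
    unfolding last_def by (rule Max_ge[OF fin]) (use that in simp)
  define k where "k = rec_nat (last 0) (\<lambda>_ i. last (Suc i))"
  have k: "k 0 = last 0" "k (Suc j) = last (Suc (k j))" for j by (simp_all add: k_def)
  have max: "i \<le> k j" if "q i = q (k j)" for i j
    using that by (cases j) (auto simp: k q_last intro: last_ge)
  have "k j < k (Suc j)" for j using last_ge[of "Suc (k j)" "Suc (k j)"] by (simp add: k)
  then have mono: "strict_mono k" by (simp add: strict_mono_Suc_iff)
  show ?thesis
  proof (intro exI[of _ "\<lambda>j. q (k j)"] conjI allI)
    show "inj (\<lambda>j. q (k j))"
    proof (rule injI)
      fix i j assume "q (k i) = q (k j)"
      then have "k i = k j" using max[of "k i" j] max[of "k j" i] by simp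
      then show "i = j" using strict_mono_eq[OF mono] by simp
    qed
    \<comment> \<open>As \<open>k j\<close> is a last visit, the next value differs, so the step is
      not a repetition.\<close>
    show "q (k (Suc j)) \<in> N (q (k j))" for j
      using step[of "k j"] max[of "Suc (k j)" j] by (auto simp: k q_last)
  qed auto
qed

definition shell :: "nat \<Rightarrow> real \<Rightarrow> real \<Rightarrow> 'a::euclidean_space \<Rightarrow> 'a set" where
  "shell n s t z = {snap n y | x y. snap n x = z \<and> s < dist x y \<and> dist x y < t}"

lemma shell_integral: "shell n s t z \<subseteq> integral_points"
  by (auto simp: shell_def snap_integral)

text \<open>The lengths along a descending chain converge to some \<open>a\<close>, and points
  shared by consecutive pairs form a walk whose proper steps have nearly length \<open>a\<close>.
  The limit may be 0, in which case \<open>s\<close> is negative.\<close>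

lemma not_wf_descent_path:
  fixes L :: "'a::euclidean_space set"
  assumes lf: "loc_finite L" and nwf: "\<not> wf (descent L)"
  shows "\<exists>a\<ge>0. \<forall>s<a. \<forall>t>a. \<forall>n. \<exists>f. inj f \<and> (\<forall>i::nat. f i \<in> snap n ` L \<and> f (Suc i) \<in> shell n s t (f i))"
proof -
  obtain e where e: "\<And>i. (e (Suc i), e i) \<in> descent L"
    using nwf by (auto simp: wf_iff_no_infinite_down_chain)
  define V where "V i = {fst (e i), snd (e i)}" for i :: nat
  define len where "len i = dist (fst (e i)) (snd (e i))" for i
  have len_Suc: "len (Suc i) < len i" for i
    using e[of i] by (auto simp: descent_def len_def split: prod.splits)
  \<comment> \<open>The first pair of the chain need not lie in \<open>L\<close>, whence the shift
    of the index.\<close>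
  have VL: "V (Suc i) \<subseteq> L" for i
    using e[of i] by (auto simp: descent_def V_def split: prod.splits)
  have "V (Suc i) \<inter> V i \<noteq> {}" for i
    using e[of i] by (auto simp: descent_def V_def split: prod.splits)
  then have "\<forall>i. \<exists>v. v \<in> V (Suc i) \<and> v \<in> V i" by blast
  then obtain p where p: "\<And>i. p i \<in> V (Suc i)" "\<And>i. p i \<in> V i" by metis
  have dec: "len j < len i" if "i < j" for i j
    using that by (induction rule: strict_inc_induct) (auto intro: len_Suc less_trans)
  have inj_len: "inj len"
    by (rule injI) (metis dec less_irrefl nat_neq_iff)
  have "decseq len" unfolding decseq_Suc_iff using len_Suc by (simp add: less_imp_le)
  then obtain a where a: "len \<longlonglongrightarrow> a" "\<And>i. a \<le> len i"
    using decseq_convergent[of len 0] by (auto simp: len_def)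
  have "0 \<le> a" by (rule LIMSEQ_le_const[OF a(1)]) (auto simp: len_def)
  \<comment> \<open>The pairs through \<open>v\<close> have different lengths, so their other
    endpoints are different points of \<open>L\<close> in a bounded set.\<close>
  have visits: "finite {i. p i = v}" for v
  proof -
    define J where "J = {j. v \<in> V (Suc j)}"
    define g where "g j = (if fst (e (Suc j)) = v then snd (e (Suc j)) else fst (e (Suc j)))" for j
    have g: "dist v (g j) = len (Suc j)" "g j \<in> L" if "j \<in> J" for j
      using that VL[of j] by (auto simp: J_def g_def V_def len_def dist_commute)
    have "inj_on g J"
    proof (rule inj_onI)
      fix i j assume "i \<in> J" "j \<in> J" "g i = g j"
      then have "len (Suc i) = len (Suc j)" by (simp flip: g(1))
      then show "i = j" using inj_len by (auto dest: injD)
    qed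
    moreover have "g ` J \<subseteq> L \<inter> cball v (len 0)"
      using g dec[of 0] by (auto simp: less_imp_le)
    then have "finite (g ` J)"
      by (rule finite_subset) (use lf in \<open>simp add: loc_finite_def\<close>)
    ultimately have "finite J" using finite_imageD by blast
    moreover have "{i. p i = v} \<subseteq> J" using p by (auto simp: J_def)
    ultimately show ?thesis by (rule rev_finite_subset)
  qed
  show ?thesis
  proof (intro exI[of _ a] conjI allI impI \<open>0 \<le> a\<close>)
    fix s t :: real and n :: nat assume s: "s < a" and t: "t > a"
    obtain N where N: "\<And>i. i \<ge> N \<Longrightarrow> len i < t"
      using order_tendstoD(2)[OF a(1) t] by (auto simp: eventually_sequentially)
    define q where "q i = snap n (p (i + N))" for i
    have pL: "p i \<in> L" for i using p(1)[of i] VL[of i] by blast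
    have "finite {i. q i = z}" for z
    proof -
      have "finite (\<Union>v\<in>L \<inter> cell n z. {i. p i = v})" using visits finite_cell[OF lf] by blast
      moreover have "(\<lambda>i. i + N) ` {i. q i = z} \<subseteq> (\<Union>v\<in>L \<inter> cell n z. {i. p i = v})"
        using pL by (auto simp: q_def cell_def)
      ultimately have "finite ((\<lambda>i. i + N) ` {i. q i = z})" by (rule rev_finite_subset)
      then show ?thesis by (rule finite_imageD) simp
    qed
    moreover have "q (Suc i) = q i \<or> q (Suc i) \<in> shell n s t (q i)" for i
    proof (cases "p (Suc i + N) = p (i + N)")
      case False
      have "p (Suc i + N) \<in> V (Suc (i + N))" "p (i + N) \<in> V (Suc (i + N))"
        using p(2)[of "Suc i + N"] p(1)[of "i + N"] by auto
      then have "dist (p (i + N)) (p (Suc i + N)) = len (Suc (i + N))"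
        using False by (auto simp: V_def len_def dist_commute)
      moreover have "s < len (Suc (i + N))" "len (Suc (i + N)) < t"
        using a(2)[of "Suc (i + N)"] s N[of "Suc (i + N)"] by auto
      ultimately have "q (Suc i) \<in> shell n s t (q i)"
        unfolding q_def shell_def
        by (intro CollectI exI[of _ "p (i + N)"] exI[of _ "p (Suc i + N)"]) simp
      then show ?thesis ..
    qed (simp add: q_def)
    ultimately obtain f where "inj f" "range f \<subseteq> range q" "\<forall>i. f (Suc i) \<in> shell n s t (f i)"
      using loop_erasure[of q "shell n s t"] by blast
    moreover have "range q \<subseteq> snap n ` L" using pL by (auto simp: q_def)
    ultimately show "\<exists>f. inj f \<and> (\<forall>i. f i \<in> snap n ` L \<and> f (Suc i) \<in> shell n s t (f i))"
      by (intro exI[of _ f]) blast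
  qed
qed

section \<open>Volumes and numbers of cells\<close>

lemma cell_borel: "cell n z \<in> sets (borel :: 'a::euclidean_space measure)"
proof -
  have "snap n \<in> borel_measurable (borel :: 'a measure)"
    unfolding snap_def[abs_def] by measurable
  then have "snap n -` {z} \<inter> space (borel :: 'a measure) \<in> sets borel" by (rule measurable_sets) simp
  then show ?thesis by (simp add: cell_def vimage_def)
qed

lemma cell_box:
  fixes z :: "'a::euclidean_space"
  assumes "z \<in> integral_points"
  shows "cell n z = {x. \<forall>i\<in>Basis. z \<bullet> i \<le> 2 ^ n * (x \<bullet> i) \<and> 2 ^ n * (x \<bullet> i) < z \<bullet> i + 1}"
proof -
  have "snap n x = z \<longleftrightarrow> (\<forall>i\<in>Basis. z \<bullet> i \<le> 2 ^ n * (x \<bullet> i) \<and> 2 ^ n * (x \<bullet> i) < z \<bullet> i + 1)" for x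
  proof -
    have "of_int \<lfloor>2 ^ n * (x \<bullet> i)\<rfloor> = z \<bullet> i \<longleftrightarrow> z \<bullet> i \<le> 2 ^ n * (x \<bullet> i) \<and> 2 ^ n * (x \<bullet> i) < z \<bullet> i + 1"
      if i: "i \<in> Basis" for i
    proof -
      obtain k where "z \<bullet> i = of_int k" using assms i by (auto simp: integral_points_def Ints_def)
      then show ?thesis by (simp add: floor_eq_iff)
    qed
    then show ?thesis by (simp add: euclidean_eq_iff[of "snap n x"] snap_inner)
  qed
  then show ?thesis by (simp add: cell_def)
qed

text \<open>The half-open cube lies between an open and a closed box of the same volume.\<close>

lemma measure_cell:
  fixes z :: "'a::euclidean_space"
  assumes "z \<in> integral_points"
  shows "measure lborel (cell n z) = (1 / 2 ^ n) ^ DIM('a)"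
proof -
  define a where "a = z /\<^sub>R 2 ^ n"
  define b where "b = (z + One) /\<^sub>R 2 ^ n"
  have ab: "a \<bullet> i = (z \<bullet> i) / 2 ^ n" "b \<bullet> i = (z \<bullet> i + 1) / 2 ^ n" if "i \<in> Basis" for i
    using that by (simp_all add: a_def b_def inner_add_left divide_inverse)
  have d: "b \<bullet> i - a \<bullet> i = 1 / 2 ^ n" "a \<bullet> i \<le> b \<bullet> i" if "i \<in> Basis" for i
    using that by (simp_all add: ab divide_right_mono flip: diff_divide_distrib)
  have "box a b \<subseteq> cell n z" "cell n z \<subseteq> cbox a b"
    unfolding cell_box[OF assms] by (auto simp: mem_box ab field_simps less_imp_le)
  moreover have "emeasure lborel (cbox a b) < \<infinity>" by (simp add: emeasure_lborel_cbox_eq)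
  ultimately have "measure lborel (box a b) \<le> measure lborel (cell n z)"
    "measure lborel (cell n z) \<le> measure lborel (cbox a b)"
    using cell_borel[of n z] bounded_cell[of n z]
    by (auto intro!: measure_mono_fmeasurable fmeasurableI emeasure_bounded_finite)
  moreover have "measure lborel (cbox a b) = (1 / 2 ^ n) ^ DIM('a)"
    "measure lborel (box a b) = (1 / 2 ^ n) ^ DIM('a)"
    using d by (simp_all add: measure_lborel_cbox_eq measure_lborel_box_eq inner_diff_left)
  ultimately show ?thesis by simp
qed

lemma card_cells_le_measure:
  fixes S :: "'a::euclidean_space set"
  assumes S: "finite S" "S \<subseteq> integral_points" "(\<Union>z\<in>S. cell n z) \<subseteq> B" and B: "B \<in> sets borel" "bounded B"
  shows "real (card S) * (1 / 2 ^ n) ^ DIM('a) \<le> measure lborel B"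
proof -
  have fm: "cell n z \<in> fmeasurable lborel" for z :: 'a
    using cell_borel[of n z] bounded_cell[of n z] by (auto intro!: fmeasurableI emeasure_bounded_finite)
  have "real (card S) * (1 / 2 ^ n) ^ DIM('a) = (\<Sum>z\<in>S. measure lborel (cell n z))"
    using S(2) by (subst sum.cong[OF refl measure_cell]) auto
  also have "\<dots> = measure lborel (\<Union>z\<in>S. cell n z)"
    by (intro measure_UNION_AE[symmetric] S(1) fm) (auto simp: pairwise_def cell_def)
  also have "\<dots> \<le> measure lborel B"
    using S fm B by (intro measure_mono_fmeasurable) (auto intro!: fmeasurableI emeasure_bounded_finite cell_borel)
  finally show ?thesis .
qed

text \<open>This makes the volume of an annulus at most proportional to its width.\<close>

lemma power_diff_le:
  fixes a b :: real
  assumes "0 \<le> a" "a \<le> b"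
  shows "b ^ Suc d - a ^ Suc d \<le> real (Suc d) * (b - a) * b ^ d"
proof (induction d)
  case (Suc d)
  have "b ^ Suc (Suc d) - a ^ Suc (Suc d) = b * (b ^ Suc d - a ^ Suc d) + (b - a) * a ^ Suc d"
    by (simp add: algebra_simps)
  also have "\<dots> \<le> b * (real (Suc d) * (b - a) * b ^ d) + (b - a) * b ^ Suc d"
    using assms Suc by (intro add_mono mult_left_mono power_mono) auto
  also have "\<dots> = real (Suc (Suc d)) * (b - a) * b ^ Suc d" by (simp add: algebra_simps)
  finally show ?case .
qed simp

text \<open>The surface area of the unit sphere.\<close>

definition shell_const :: "'a::euclidean_space itself \<Rightarrow> real" where
  "shell_const _ = unit_ball_vol (real DIM('a)) * real DIM('a)"

text \<open>All cells of the shell lie in one annulus around a point of the cell \<open>z\<close>,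
  with both radii relaxed by two meshes: one for each end of the distance.\<close>

lemma shell_card:
  fixes z :: "'a::euclidean_space"
  assumes "0 < t" "s < t"
  shows "finite (shell n s t z)"
    and "real (card (shell n s t z)) * (1 / 2 ^ n) ^ DIM('a) \<le>
      shell_const TYPE('a) * (t - s + 4 * mesh TYPE('a) n) * (t + 2 * mesh TYPE('a) n) ^ (DIM('a) - 1)"
proof -
  define e where "e = mesh TYPE('a) n"
  have e: "e > 0" by (simp add: e_def mesh_pos)
  have "finite (shell n s t z) \<and> real (card (shell n s t z)) * (1 / 2 ^ n) ^ DIM('a) \<le>
      shell_const TYPE('a) * (t - s + 4 * e) * (t + 2 * e) ^ (DIM('a) - 1)"
  proof (cases "\<exists>p. snap n p = z")
    case False
    then have "shell n s t z = {}" by (auto simp: shell_def)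
    then show ?thesis using assms e by (auto simp: shell_const_def intro!: mult_nonneg_nonneg)
  next
    case True
    then obtain p where p: "snap n p = z" by auto
    \<comment> \<open>The inner radius is cut off at 0 since \<open>s\<close> may be small or
      negative.\<close>
    define a where "a = max 0 (s - 2 * e)"
    define b where "b = t + 2 * e"
    have ab: "0 \<le> a" "a \<le> b" "b - a \<le> t - s + 4 * e" using assms e by (auto simp: a_def b_def)
    have near: "dist p y \<le> b \<and> s - 2 * e < dist p y" if y: "snap n y \<in> shell n s t z" for y
    proof -
      obtain u v where uv: "snap n u = z" "snap n v = snap n y" "s < dist u v" "dist u v < t"
        using y by (auto simp: shell_def)
      have "dist p u \<le> e" "dist v y \<le> e" using uv p by (auto simp: e_def intro: snap_dist)
      then show ?thesis
        using uv dist_triangle[of p y u] dist_triangle[of u y v] dist_triangle[of u v p] dist_triangle[of p v y]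
        by (auto simp: b_def dist_commute)
    qed
    have sub: "shell n s t z \<subseteq> snap n ` cball p b"
    proof
      fix w assume w: "w \<in> shell n s t z"
      then obtain y where "w = snap n y" by (auto simp: shell_def)
      then show "w \<in> snap n ` cball p b" using near[of y] w by auto
    qed
    then have fin: "finite (shell n s t z)" by (rule finite_subset) (simp add: finite_snap_image)
    have "real (card (shell n s t z)) * (1 / 2 ^ n) ^ DIM('a) \<le> measure lborel (cball p b - ball p a)"
    proof (rule card_cells_le_measure[OF fin])
      show "shell n s t z \<subseteq> integral_points" by (auto simp: shell_def snap_integral)
      show "(\<Union>z\<in>shell n s t z. cell n z) \<subseteq> cball p b - ball p a"
      proof (intro UN_least subsetI)
        fix w y assume "w \<in> shell n s t z" "y \<in> cell n w"
        then have y: "dist p y \<le> b" "s - 2 * e < dist p y" using near[of y] by (auto simp: cell_def)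
        then have "a \<le> dist p y" by (simp add: a_def)
        then show "y \<in> cball p b - ball p a" using y by simp
      qed
    qed (auto intro: bounded_diff)
    also have "\<dots> = measure lborel (cball p b) - measure lborel (ball p a)"
      using ab emeasure_bounded_finite[OF bounded_cball, of p b]
      by (intro measure_Diff) (auto simp: less_top[symmetric])
    also have "\<dots> = unit_ball_vol (real DIM('a)) * (b ^ DIM('a) - a ^ DIM('a))"
      using ab by (simp add: content_cball content_ball algebra_simps)
    also have "\<dots> \<le> unit_ball_vol (real DIM('a)) * (real DIM('a) * (b - a) * b ^ (DIM('a) - 1))"
      using power_diff_le[OF ab(1,2), of "DIM('a) - 1"] by (intro mult_left_mono) auto
    also have "\<dots> = shell_const TYPE('a) * (b - a) * b ^ (DIM('a) - 1)"
      by (simp add: shell_const_def)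
    also have "\<dots> \<le> shell_const TYPE('a) * (t - s + 4 * e) * b ^ (DIM('a) - 1)"
      using ab by (intro mult_right_mono mult_left_mono) (auto simp: shell_const_def)
    finally show ?thesis using fin by (simp add: b_def)
  qed
  then show "finite (shell n s t z)"
    and "real (card (shell n s t z)) * (1 / 2 ^ n) ^ DIM('a) \<le>
      shell_const TYPE('a) * (t - s + 4 * mesh TYPE('a) n) * (t + 2 * mesh TYPE('a) n) ^ (DIM('a) - 1)"
    by (auto simp: e_def)
qed

lemma countable_integral_points: "countable (integral_points :: 'a::euclidean_space set)"
proof -
  have "integral_points \<subseteq> (\<Union>k::nat. integral_points \<inter> cball (0::'a) (real k))"
  proof
    fix z :: 'a assume "z \<in> integral_points"
    moreover obtain k :: nat where "norm z \<le> real k" using real_arch_simple by blast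
    ultimately show "z \<in> (\<Union>k::nat. integral_points \<inter> cball (0::'a) (real k))"
      by (intro UN_I[of k]) auto
  qed
  moreover have "countable (\<Union>k::nat. integral_points \<inter> cball (0::'a) (real k))"
    by (rule countable_UN[OF countableI_type]) (simp add: countable_finite finite_integral_points)
  ultimately show ?thesis by (rule countable_subset)
qed

section \<open>Cell counts\<close>

text \<open>Independence of counts is given for families indexed by \<open>{..<n}\<close>; this
  carries it to families indexed by cells.\<close>

lemma (in prob_space) indep_vars_reindex:
  assumes h: "inj_on h I" and X: "indep_vars (\<lambda>i. N (h i)) (\<lambda>i. X (h i)) I"
  shows "indep_vars N X (h ` I)"
  unfolding indep_vars_def2
proof (intro conjI ballI)
  show "random_variable (N j) (X j)" if "j \<in> h ` I" for j
    using X that by (auto simp: indep_vars_def2)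
  let ?F = "\<lambda>j. {X j -` A \<inter> space M |A. A \<in> sets (N j)}"
  have F: "indep_sets (\<lambda>i. ?F (h i)) I" using X by (simp add: indep_vars_def2)
  show "indep_sets ?F (h ` I)"
    unfolding indep_sets_def
  proof (intro conjI ballI allI impI)
    show "?F j \<subseteq> events" if "j \<in> h ` I" for j using F that by (auto simp: indep_sets_def)
    fix J A assume J: "J \<subseteq> h ` I" "J \<noteq> {}" "finite J" and A: "A \<in> Pi J ?F"
    from J(1) obtain K where K: "K \<subseteq> I" "J = h ` K" by (auto simp: subset_image_iff)
    have inj: "inj_on h K" using h K(1) by (rule inj_on_subset)
    have "prob (\<Inter>i\<in>K. A (h i)) = (\<Prod>i\<in>K. prob (A (h i)))"
    proof (rule indep_setsD[OF F K(1)])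
      show "K \<noteq> {}" using J K by auto
      show "finite K" using J(3) inj unfolding K by (rule finite_imageD)
      show "\<forall>i\<in>K. A (h i) \<in> ?F (h i)" using A K by auto
    qed
    then show "prob (\<Inter>j\<in>J. A j) = (\<Prod>j\<in>J. prob (A j))"
      unfolding K by (simp add: prod.reindex[OF inj])
  qed
qed

text \<open>The event that all \<open>E n\<close> with \<open>n \<ge> k\<close> occur has at most
  the probability of each of them, hence probability 0.\<close>

lemma (in prob_space) AE_frequently_not:
  assumes E: "\<And>n. E n \<in> events" and lim: "(\<lambda>n. prob (E n)) \<longlonglongrightarrow> 0"
  shows "AE \<omega> in M. \<exists>\<^sub>F n in sequentially. \<omega> \<notin> E n"
proof -
  have null: "AE \<omega> in M. \<not> (\<forall>n\<ge>k. \<omega> \<in> E n)" for k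
  proof -
    define B where "B = (\<Inter>n\<in>{k..}. E n)"
    have B: "B \<in> events" unfolding B_def using E by (intro sets.countable_INT) auto
    have "prob B \<le> prob (E n)" if "n \<ge> k" for n
      using that B E by (intro finite_measure_mono) (auto simp: B_def)
    then have "prob B \<le> 0" by (intro LIMSEQ_le_const[OF lim]) auto
    then have "prob B = 0" by (simp add: measure_le_0_iff)
    then have "AE \<omega> in M. \<omega> \<notin> B" using B by (simp add: prob_eq_0)
    then show ?thesis by (rule AE_mp) (auto simp: B_def)
  qed
  then have "AE \<omega> in M. \<forall>k. \<not> (\<forall>n\<ge>k. \<omega> \<in> E n)" by (simp add: AE_all_countable)
  then show ?thesis
    by (rule AE_mp) (auto simp: frequently_def eventually_sequentially)
qed

context poisson_point_process
begin

definition count :: "nat \<Rightarrow> 'a \<Rightarrow> 'w \<Rightarrow> nat" where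
  "count n z \<omega> = card (L \<omega> \<inter> cell n z)"

definition cell_mean :: "nat \<Rightarrow> real" where
  "cell_mean n = intensity * (1 / 2 ^ n) ^ DIM('a)"

lemma measurable_cell_count [measurable]: "count n z \<in> measurable M (count_space UNIV)"
  unfolding count_def[abs_def] by (rule measurable_count[OF cell_borel bounded_cell])

lemma prob_cell_count:
  assumes "z \<in> integral_points"
  shows "prob {\<omega> \<in> space M. count n z \<omega> = k} = cell_mean n ^ k / fact k * exp (- cell_mean n)"
  using poisson_count[OF cell_borel bounded_cell, of n z k]
  by (simp add: count_def cell_mean_def measure_cell[OF assms])

lemma AE_loc_finite: "AE \<omega> in M. loc_finite (L \<omega>)"
  using locally_finite by (simp add: loc_finite_def)

lemma indep_counts_family:
  fixes B :: "'i \<Rightarrow> 'a set"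
  assumes I: "finite I" and B: "\<And>i. i \<in> I \<Longrightarrow> B i \<in> sets borel \<and> bounded (B i)" and disj: "disjoint_family_on B I"
  shows "indep_vars (\<lambda>_. count_space UNIV) (\<lambda>i \<omega>. card (L \<omega> \<inter> B i)) I"
proof -
  obtain h where h: "bij_betw h {0..<card I} I" using ex_bij_betw_nat_finite[OF I] by auto
  have hI: "h ` {..<card I} = I" and inj: "inj_on h {..<card I}"
    using h by (auto simp: bij_betw_def lessThan_atLeast0)
  have "indep_vars (\<lambda>_. count_space UNIV) (\<lambda>i \<omega>. card (L \<omega> \<inter> (B \<circ> h) i)) {..<card I}"
  proof (rule indep_counts)
    show "(B \<circ> h) i \<in> sets borel \<and> bounded ((B \<circ> h) i)" if "i < card I" for i
      using B[of "h i"] hI that by auto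
    show "disjoint_family_on (B \<circ> h) {..<card I}"
      unfolding disjoint_family_on_def
    proof (intro ballI impI)
      fix i j assume ij: "i \<in> {..<card I}" "j \<in> {..<card I}" "i \<noteq> j"
      then have "h i \<noteq> h j" "h i \<in> I" "h j \<in> I" using inj hI by (auto dest: inj_onD)
      then show "(B \<circ> h) i \<inter> (B \<circ> h) j = {}" using disj by (auto simp: disjoint_family_on_def)
    qed
  qed
  then have "indep_vars (\<lambda>_. count_space UNIV) (\<lambda>i \<omega>. card (L \<omega> \<inter> B i)) (h ` {..<card I})"
    by (intro indep_vars_reindex inj) simp
  then show ?thesis by (simp add: hI)
qed

lemma indep_cell_counts:
  assumes "finite Z"
  shows "indep_vars (\<lambda>_. count_space UNIV) (count n) Z"
proof -
  have "disjoint_family_on (cell n) Z" by (auto simp: disjoint_family_on_def cell_def)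
  then show ?thesis
    unfolding count_def[abs_def]
    by (rule indep_counts_family[OF assms, rotated]) (simp add: cell_borel bounded_cell)
qed

end

section \<open>First moment bounds and well-foundedness of \<open>descent\<close>\<close>

locale intense_poisson_point_process = poisson_point_process M L intensity
  for M :: "'w measure" and L :: "'w \<Rightarrow> 'a::euclidean_space set" and intensity +
  assumes intensity_pos: "intensity > 0"
begin

lemma cell_mean_pos: "cell_mean n > 0"
  using intensity_pos by (simp add: cell_mean_def)

lemma cell_mean_nonneg: "cell_mean n \<ge> 0"
  using cell_mean_pos[of n] by simp

text \<open>Independence of the cells, together with \<open>1 - exp (- t) \<le> t\<close> for each
  factor.\<close>

lemma prob_occupied_le:
  assumes "finite Z" "Z \<subseteq> integral_points"
  shows "prob {\<omega> \<in> space M. \<forall>z\<in>Z. count n z \<omega> > 0} \<le> cell_mean n ^ card Z"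
proof (cases "Z = {}")
  case False
  have eq: "{\<omega> \<in> space M. \<forall>z\<in>Z. count n z \<omega> > 0} = (\<Inter>z\<in>Z. count n z -` {0<..} \<inter> space M)"
    using False by auto
  have "prob {\<omega> \<in> space M. \<forall>z\<in>Z. count n z \<omega> > 0} = (\<Prod>z\<in>Z. prob (count n z -` {0<..} \<inter> space M))"
    unfolding eq by (rule indep_varsD_finite[OF indep_cell_counts]) (use assms False in auto)
  also have "\<dots> \<le> (\<Prod>z\<in>Z. cell_mean n)"
  proof (rule prod_mono, intro conjI measure_nonneg)
    fix z assume z: "z \<in> Z"
    have "prob (count n z -` {0<..} \<inter> space M) = prob (space M - {\<omega> \<in> space M. count n z \<omega> = 0})"
      by (rule arg_cong[where f = prob]) auto
    also have "\<dots> = 1 - exp (- cell_mean n)"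
      using z assms prob_cell_count[of z n 0] by (subst prob_compl) auto
    also have "\<dots> \<le> cell_mean n" using exp_ge_add_one_self[of "- cell_mean n"] by linarith
    finally show "prob (count n z -` {0<..} \<inter> space M) \<le> cell_mean n" .
  qed
  finally show ?thesis by simp
qed simp

definition some_occupied :: "nat \<Rightarrow> 'a set set \<Rightarrow> 'w set" where
  "some_occupied n F = {\<omega> \<in> space M. \<exists>Z\<in>F. \<forall>z\<in>Z. count n z \<omega> > 0}"

lemma some_occupied:
  assumes F: "finite F" "\<And>Z. Z \<in> F \<Longrightarrow> finite Z \<and> Z \<subseteq> integral_points \<and> card Z = l"
  shows "some_occupied n F \<in> events" "prob (some_occupied n F) \<le> real (card F) * cell_mean n ^ l"
proof -
  let ?E = "\<lambda>Z. {\<omega> \<in> space M. \<forall>z\<in>Z. count n z \<omega> > 0}"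
  have E: "?E Z \<in> events" if "Z \<in> F" for Z
    using F(2)[OF that] by (intro sets.sets_Collect_finite_All) auto
  have eq: "some_occupied n F = (\<Union>Z\<in>F. ?E Z)" by (auto simp: some_occupied_def)
  show "some_occupied n F \<in> events" unfolding eq using F E by (intro sets.finite_UN) auto
  have "prob (some_occupied n F) \<le> (\<Sum>Z\<in>F. prob (?E Z))"
    unfolding eq using E by (intro finite_measure_subadditive_finite F) auto
  also have "\<dots> \<le> (\<Sum>Z\<in>F. cell_mean n ^ l)"
  proof (rule sum_mono)
    fix Z assume "Z \<in> F"
    with F(2)[OF this] prob_occupied_le[of Z n] show "prob (?E Z) \<le> cell_mean n ^ l" by auto
  qed
  finally show "prob (some_occupied n F) \<le> real (card F) * cell_mean n ^ l" by simp
qed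

text \<open>Self-avoiding walks with \<open>l\<close> steps, latest point first. Self-avoidance
  makes the visited cells distinct, so that their counts are independent.\<close>

fun walks :: "('a \<Rightarrow> 'a set) \<Rightarrow> 'a \<Rightarrow> nat \<Rightarrow> 'a list set" where
  "walks N z 0 = {[z]}"
| "walks N z (Suc l) = {y # zs | y zs. zs \<in> walks N z l \<and> y \<in> N (hd zs) \<and> y \<notin> set zs}"

declare walks.simps(2) [simp del]

text \<open>A subcritical first moment bound: each step contributes a factor of at most 1/2 to the
  number of walks times the occupation probability.\<close>

lemma AE_no_occupied_path:
  assumes N: "\<And>z. finite (N z) \<and> N z \<subseteq> integral_points \<and> real (card (N z)) * cell_mean n \<le> 1 / 2"
    and z: "z \<in> integral_points"
  shows "AE \<omega> in M. \<not> (\<exists>f. f 0 = z \<and> inj f \<and> (\<forall>i::nat. count n (f i) \<omega> > 0 \<and> f (Suc i) \<in> N (f i)))"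
proof -
  have walks: "finite (walks N z l) \<and> real (card (walks N z l)) * cell_mean n ^ l \<le> (1 / 2) ^ l \<and>
    (\<forall>zs\<in>walks N z l. set zs \<subseteq> integral_points \<and> distinct zs \<and> length zs = Suc l)" for l
  proof (induction l)
    case (Suc l)
    have IH: "finite (walks N z l)" "real (card (walks N z l)) * cell_mean n ^ l \<le> (1 / 2) ^ l"
      "\<And>zs. zs \<in> walks N z l \<Longrightarrow> set zs \<subseteq> integral_points \<and> distinct zs \<and> length zs = Suc l"
      using Suc.IH by blast+
    have Nfin: "finite (N y)" for y using N by blast
    have sub: "walks N z (Suc l) \<subseteq> (\<Union>zs\<in>walks N z l. (\<lambda>y. y # zs) ` N (hd zs))"
      by (auto simp: walks.simps(2))
    have "card (walks N z (Suc l)) \<le> card (\<Union>zs\<in>walks N z l. (\<lambda>y. y # zs) ` N (hd zs))"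
      by (intro card_mono[OF _ sub]) (simp add: IH(1) Nfin)
    also have "\<dots> \<le> (\<Sum>zs\<in>walks N z l. card ((\<lambda>y. y # zs) ` N (hd zs)))"
      by (rule card_UN_le[OF IH(1)])
    also have "\<dots> \<le> (\<Sum>zs\<in>walks N z l. card (N (hd zs)))"
      by (intro sum_mono card_image_le Nfin)
    finally have "real (card (walks N z (Suc l))) \<le> (\<Sum>zs\<in>walks N z l. real (card (N (hd zs))))"
      by (metis of_nat_le_iff of_nat_sum)
    then have "real (card (walks N z (Suc l))) * cell_mean n \<le> (\<Sum>zs\<in>walks N z l. real (card (N (hd zs)))) * cell_mean n"
      by (intro mult_right_mono) (simp_all add: cell_mean_nonneg)
    also have "\<dots> = (\<Sum>zs\<in>walks N z l. real (card (N (hd zs))) * cell_mean n)" by (rule sum_distrib_right)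
    also have "\<dots> \<le> (\<Sum>zs\<in>walks N z l. 1 / 2)" using N by (intro sum_mono) blast
    finally have "real (card (walks N z (Suc l))) * cell_mean n * cell_mean n ^ l \<le> (real (card (walks N z l)) * (1 / 2)) * cell_mean n ^ l"
      by (intro mult_right_mono) (simp_all add: cell_mean_nonneg)
    also have "\<dots> \<le> (1 / 2) ^ Suc l" using IH(2) by simp
    finally have W1: "real (card (walks N z (Suc l))) * cell_mean n ^ Suc l \<le> (1 / 2) ^ Suc l"
      by (simp only: power_Suc mult.assoc)
    have W2: "finite (walks N z (Suc l))" by (rule finite_subset[OF sub]) (simp add: IH(1) Nfin)
    have W3: "\<forall>zs\<in>walks N z (Suc l). set zs \<subseteq> integral_points \<and> distinct zs \<and> length zs = Suc (Suc l)"
    proof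
      fix zs assume "zs \<in> walks N z (Suc l)"
      then obtain y zs' where zs: "zs = y # zs'" "zs' \<in> walks N z l" "y \<in> N (hd zs')" "y \<notin> set zs'"
        by (auto simp: walks.simps(2))
      have "y \<in> integral_points" using N[of "hd zs'"] zs(3) by auto
      then show "set zs \<subseteq> integral_points \<and> distinct zs \<and> length zs = Suc (Suc l)"
        using IH(3)[OF zs(2)] zs(1,4) by simp
    qed
    show ?case by (intro conjI W1 W2 W3)
  qed (use z in auto)
  define E where "E l = some_occupied n (set ` walks N z l)" for l
  have F: "finite (set ` walks N z l)" "\<And>Z. Z \<in> set ` walks N z l \<Longrightarrow> finite Z \<and> Z \<subseteq> integral_points \<and> card Z = Suc l" for l
    using walks[of l] by (auto simp: distinct_card)
  \<comment> \<open>A walk with \<open>l\<close> steps visits \<open>l + 1\<close> cells, which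
    leaves one factor \<open>cell_mean n\<close>.\<close>
  have "prob (E l) \<le> (1 / 2) ^ l * cell_mean n" for l
  proof -
    have "prob (E l) \<le> real (card (set ` walks N z l)) * cell_mean n ^ Suc l"
      unfolding E_def by (rule some_occupied(2)[OF F])
    also have "\<dots> \<le> real (card (walks N z l)) * cell_mean n ^ Suc l"
      using walks[of l] by (intro mult_right_mono) (simp_all add: card_image_le cell_mean_nonneg)
    also have "\<dots> = real (card (walks N z l)) * cell_mean n ^ l * cell_mean n" by simp
    also have "\<dots> \<le> (1 / 2) ^ l * cell_mean n"
      using walks[of l] by (intro mult_right_mono) (simp_all add: cell_mean_nonneg)
    finally show ?thesis .
  qed
  note bound = this
  have "(\<lambda>l. prob (E l)) \<longlonglongrightarrow> 0"
  proof (rule tendsto_sandwich[where f = "\<lambda>_. 0" and h = "\<lambda>l. (1 / 2) ^ l * cell_mean n"])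
    show "(\<lambda>l. (1 / 2) ^ l * cell_mean n) \<longlonglongrightarrow> 0"
      by (intro tendsto_mult_left_zero LIMSEQ_realpow_zero) simp_all
    show "\<forall>\<^sub>F l in sequentially. prob (E l) \<le> (1 / 2) ^ l * cell_mean n"
      by (intro always_eventually allI bound)
    show "\<forall>\<^sub>F l in sequentially. 0 \<le> prob (E l)" by simp
    show "(\<lambda>l::nat. 0::real) \<longlonglongrightarrow> 0" by simp
  qed
  then have "AE \<omega> in M. \<exists>\<^sub>F l in sequentially. \<omega> \<notin> E l"
    by (rule AE_frequently_not[rotated]) (simp add: E_def some_occupied(1)[OF F])
  then show ?thesis
  proof (rule AE_mp, intro AE_I2 impI notI)
    fix \<omega> assume \<omega>: "\<omega> \<in> space M" and freq: "\<exists>\<^sub>F l in sequentially. \<omega> \<notin> E l"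
    assume "\<exists>f. f 0 = z \<and> inj f \<and> (\<forall>i::nat. count n (f i) \<omega> > 0 \<and> f (Suc i) \<in> N (f i))"
    then obtain f where f: "f 0 = z" "inj f" "\<And>i::nat. count n (f i) \<omega> > 0" "\<And>i. f (Suc i) \<in> N (f i)" by auto
    have "map f (rev [0..<Suc l]) \<in> walks N z l" for l
    proof (induction l)
      case (Suc l)
      have "f (Suc l) \<notin> set (map f (rev [0..<Suc l]))" using f(2) by (auto dest: injD)
      moreover have "f (Suc l) \<in> N (hd (map f (rev [0..<Suc l])))" using f(4) by simp
      ultimately have "f (Suc l) # map f (rev [0..<Suc l]) \<in> walks N z (Suc l)"
        unfolding walks.simps mem_Collect_eq using Suc by (intro exI conjI) (rule refl | assumption)+
      moreover have "map f (rev [0..<Suc (Suc l)]) = f (Suc l) # map f (rev [0..<Suc l])" by simp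
      ultimately show ?case by (simp only:)
    qed (simp add: f)
    then have mem: "set (map f (rev [0..<Suc l])) \<in> set ` walks N z l" for l by (rule imageI)
    have pos: "\<forall>y\<in>set (map f (rev [0..<Suc l])). count n y \<omega> > 0" for l using f(3) by auto
    have "\<omega> \<in> E l" for l
      unfolding E_def some_occupied_def by (intro CollectI conjI \<omega> bexI[OF _ mem[of l]]) (rule pos)
    then show False using freq by simp
  qed
qed

lemma shell_mean:
  fixes z :: 'a
  assumes "0 < t" "s < t"
  shows "real (card (shell n s t z)) * cell_mean n \<le>
    intensity * shell_const TYPE('a) * (t - s + 4 * mesh TYPE('a) n) * (t + 2 * mesh TYPE('a) n) ^ (DIM('a) - 1)"
  using mult_left_mono[OF shell_card(2)[OF assms, where 'a = 'a, of n z], of intensity] intensity_pos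
  by (simp add: cell_mean_def mult_ac)

text \<open>Around every limit length \<open>a\<close> a shell thin enough is subcritical. Rational
  radii make the excluded events countably many, although \<open>a\<close> depends on the
  configuration.\<close>

lemma AE_wf_descent: "AE \<omega> in M. wf (descent (L \<omega>))"
proof -
  define good where "good s t n \<longleftrightarrow> (\<forall>z::'a. real (card (shell n s t z)) * cell_mean n \<le> 1 / 2)" for s t n
  have paths: "AE \<omega> in M. \<forall>s\<in>\<rat>. \<forall>t\<in>\<rat>. \<forall>n. \<forall>z\<in>integral_points. s < t \<and> 0 < t \<and> good s t n \<longrightarrow>
     \<not> (\<exists>f. f 0 = z \<and> inj f \<and> (\<forall>i::nat. count n (f i) \<omega> > 0 \<and> f (Suc i) \<in> shell n s t (f i)))"
    unfolding AE_ball_countable[OF countable_rat] AE_all_countable AE_ball_countable[OF countable_integral_points]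
  proof (intro ballI allI)
    fix s t :: real and n and z :: 'a assume z: "z \<in> integral_points"
    show "AE \<omega> in M. s < t \<and> 0 < t \<and> good s t n \<longrightarrow>
      \<not> (\<exists>f. f 0 = z \<and> inj f \<and> (\<forall>i::nat. count n (f i) \<omega> > 0 \<and> f (Suc i) \<in> shell n s t (f i)))"
    proof (cases "s < t \<and> 0 < t \<and> good s t n")
      case True
      then have "finite (shell n s t y) \<and> shell n s t y \<subseteq> integral_points \<and>
        real (card (shell n s t y)) * cell_mean n \<le> 1 / 2" for y :: 'a
        using shell_integral unfolding good_def by (blast intro: shell_card(1))
      then have "AE \<omega> in M. \<not> (\<exists>f. f 0 = z \<and> inj f \<and> (\<forall>i::nat. count n (f i) \<omega> > 0 \<and> f (Suc i) \<in> shell n s t (f i)))"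
        by (rule AE_no_occupied_path[OF _ z])
      then show ?thesis by (rule AE_mp) auto
    next
      case False
      show ?thesis by (rule AE_I2) (use False in blast)
    qed
  qed
  have good: "\<exists>s\<in>\<rat>. \<exists>t\<in>\<rat>. \<exists>n. s < a \<and> a < t \<and> good s t n" if a: "a \<ge> 0" for a :: real
  proof -
    define C where "C = intensity * shell_const TYPE('a) * (a + 3) ^ (DIM('a) - 1)"
    have C: "C > 0" using intensity_pos a by (simp add: C_def shell_const_def)
    \<comment> \<open>The width \<open>t - s\<close> is below \<open>2 * e\<close> and the four
      meshes are below \<open>4 * e\<close>, together \<open>6 * e\<close>; \<open>e \<le> 1\<close>
      keeps the outer radius below \<open>a + 3\<close>.\<close>
    define e where "e = min 1 (1 / (12 * C))"
    have e: "0 < e" "e \<le> 1" "C * (6 * e) \<le> 1 / 2"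
      using C mult_left_mono[of e "1 / (12 * C)" C] by (auto simp: e_def field_simps)
    obtain s where s: "s \<in> \<rat>" "a - e < s" "s < a" using Rats_dense_in_real[of "a - e" a] e by auto
    obtain t where t: "t \<in> \<rat>" "a < t" "t < a + e" using Rats_dense_in_real[of a "a + e"] e by auto
    obtain n where n: "1 * mesh TYPE('a) n < e"
      using eventually_mesh_less[OF e(1), of 1, where 'a = 'a] by (auto simp: eventually_sequentially)
    have "real (card (shell n s t z)) * cell_mean n \<le> 1 / 2" for z :: 'a
    proof -
      have "real (card (shell n s t z)) * cell_mean n \<le>
        intensity * shell_const TYPE('a) * (t - s + 4 * mesh TYPE('a) n) * (t + 2 * mesh TYPE('a) n) ^ (DIM('a) - 1)"
        using s t a by (intro shell_mean) auto
      also have "\<dots> \<le> intensity * shell_const TYPE('a) * (6 * e) * (a + 3) ^ (DIM('a) - 1)"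
        using s t a e n intensity_pos mesh_pos[where 'a = 'a, of n]
        by (intro mult_mono power_mono) (auto simp: shell_const_def intro!: mult_nonneg_nonneg)
      also have "\<dots> \<le> 1 / 2" using e(3) by (simp add: C_def mult_ac)
      finally show ?thesis .
    qed
    then show ?thesis using s t by (auto simp: good_def)
  qed
  show ?thesis using paths AE_loc_finite
  proof eventually_elim
    case (elim \<omega>)
    show ?case
    proof (rule ccontr)
      assume "\<not> wf (descent (L \<omega>))"
      from not_wf_descent_path[OF elim(2) this] obtain a where a: "a \<ge> 0"
        "\<forall>s<a. \<forall>t>a. \<forall>n. \<exists>f. inj f \<and> (\<forall>i::nat. f i \<in> snap n ` L \<omega> \<and> f (Suc i) \<in> shell n s t (f i))" by blast
      obtain s t n where s: "s \<in> \<rat>" "t \<in> \<rat>" "s < a" "a < t" "good s t n" using good[OF a(1)] by blast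
      then obtain f where f: "inj f" "\<And>i::nat. f i \<in> snap n ` L \<omega>" "\<And>i. f (Suc i) \<in> shell n s t (f i)"
        using a(2) by blast
      have "count n (f i) \<omega> > 0" for i
        using f(2)[of i] finite_cell[OF elim(2)] by (auto simp: count_def card_gt_0_iff cell_def)
      moreover have "f 0 \<in> integral_points" using f(2)[of 0] by (auto simp: snap_integral)
      note bspec[OF spec[OF bspec[OF bspec[OF elim(1) s(1)] s(2)], of n] this]
      moreover have "s < t" "0 < t" using s a(1) by auto
      moreover have "\<exists>g. g 0 = f 0 \<and> inj g \<and> (\<forall>i::nat. count n (g i) \<omega> > 0 \<and> g (Suc i) \<in> shell n s t (g i))"
        using f(1,3) calculation(1) by blast
      ultimately show False using s(5) by blast
    qed
  qed
qed

end

section \<open>Local criteria for undesired points\<close>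

lemma snap_translate:
  assumes "v \<in> integral_points"
  shows "snap n (x + v) = snap n x + 2 ^ n *\<^sub>R v"
proof (rule euclidean_eqI)
  fix i :: 'a assume i: "i \<in> Basis"
  obtain k where k: "v \<bullet> i = of_int k" using assms i by (auto simp: integral_points_def Ints_def)
  have "\<lfloor>2 ^ n * ((x + v) \<bullet> i)\<rfloor> = \<lfloor>2 ^ n * (x \<bullet> i) + of_int (2 ^ n * k)\<rfloor>"
    by (simp add: inner_add_left k distrib_left)
  also have "\<dots> = \<lfloor>2 ^ n * (x \<bullet> i)\<rfloor> + 2 ^ n * k" by (rule floor_add_int[symmetric])
  finally show "snap n (x + v) \<bullet> i = (snap n x + 2 ^ n *\<^sub>R v) \<bullet> i"
    using i by (simp add: snap_inner inner_add_left k)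
qed

lemma matched_translate:
  fixes v :: "'a::real_normed_vector"
  shows "matched L x y \<Longrightarrow> matched ((+) v ` L) (v + x) (v + y)"
proof (induction rule: matched.induct)
  case (matchedI x y)
  show ?case
  proof (rule matched.intros)
    show "\<forall>u\<in>(+) v ` L - {v + x, v + y}. \<forall>w\<in>{v + x, v + y}. dist u w \<le> dist (v + x) (v + y) \<longrightarrow>
      (\<exists>t. matched ((+) v ` L) u t \<and> dist u t < dist u w)"
    proof (intro ballI impI)
      fix u w assume u: "u \<in> (+) v ` L - {v + x, v + y}" and w: "w \<in> {v + x, v + y}"
        and d: "dist u w \<le> dist (v + x) (v + y)"
      obtain u' where u': "u = v + u'" "u' \<in> L - {x, y}" using u by auto
      obtain w' where w': "w = v + w'" "w' \<in> {x, y}" using w by auto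
      have "dist u' w' \<le> dist x y" using d by (simp add: u' w')
      then obtain t where "matched ((+) v ` L) (v + u') (v + t)" "dist u' t < dist u' w'"
        using matchedI.IH u'(2) w'(2) by blast
      then show "\<exists>t. matched ((+) v ` L) u t \<and> dist u t < dist u w"
        by (intro exI[of _ "v + t"]) (simp add: u' w')
    qed
  qed (use matchedI.hyps in auto)
qed

lemma undesired_translate:
  fixes v :: "'a::real_normed_vector"
  assumes "undesired R L x"
  shows "undesired R ((+) v ` L) (v + x)"
  using assms matched_translate[of L _ _ v]
  by (fastforce simp: undesired_def closer_matched_def)

text \<open>Quantifying over all configurations with the given counts turns the existence of an
  undesired point into a property of a finite pattern \<open>p\<close>, accessible to the laws of
  finitely many counts.\<close>

definition forced :: "nat \<Rightarrow> 'a::euclidean_space set \<Rightarrow> real \<Rightarrow> real \<Rightarrow> nat \<Rightarrow> ('a \<Rightarrow> nat) \<Rightarrow> bool" where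
  "forced m A r R n p \<longleftrightarrow> (\<forall>L'. loc_finite L' \<longrightarrow> (\<forall>z\<in>outer m A n. card (L' \<inter> cell n z) = p z) \<longrightarrow>
     (\<forall>a\<in>A. card (L' \<inter> cell m a) = 2) \<longrightarrow> (\<exists>x\<in>L'. norm x < r \<and> undesired R L' x))"

lemma forced_restrict: "forced m A r R n (restrict p (outer m A n)) \<longleftrightarrow> forced m A r R n p"
  by (simp add: forced_def)

lemma finite_outer: "finite (outer m A n)"
  by (rule finite_subset[OF _ finite_window]) (auto simp: outer_def)

lemma outer_integral: "outer m A n \<subseteq> integral_points"
  by (auto simp: outer_def window_def)

text \<open>The finer pattern determines the coarser one, since the subcells of an
  \<open>outer\<close> cell are \<open>outer\<close> again.\<close>

lemma forced_Suc:
  assumes L: "loc_finite L" and f: "forced m A r R n (\<lambda>z. card (L \<inter> cell n z))"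
  shows "forced m A r R (Suc n) (\<lambda>z. card (L \<inter> cell (Suc n) z))"
  unfolding forced_def
proof (intro allI impI)
  fix L' assume L': "loc_finite L'" "\<forall>z\<in>outer m A (Suc n). card (L' \<inter> cell (Suc n) z) = card (L \<inter> cell (Suc n) z)"
    "\<forall>a\<in>A. card (L' \<inter> cell m a) = 2"
  have "card (L' \<inter> cell n z) = card (L \<inter> cell n z)" if z: "z \<in> outer m A n" for z
  proof -
    have "w \<in> outer m A (Suc n)" if "w \<in> snap (Suc n) ` cell n z" for w
    proof -
      from that obtain u where u: "w = snap (Suc n) u" "snap n u = z" by (auto simp: cell_def)
      have "snap m y \<notin> A" if "y \<in> cell (Suc n) w" for y
      proof -
        have "snap n y = snap n u" by (rule snap_coarsen[of n "Suc n"]) (use that u in \<open>auto simp: cell_def\<close>)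
        then show ?thesis using z u by (auto simp: outer_def cell_def)
      qed
      then show ?thesis using z u snap_window_Suc[of n u] by (auto simp: outer_def)
    qed
    then show ?thesis
      using L'(2) by (simp add: card_cell_refine[OF L, of n "Suc n"] card_cell_refine[OF L'(1), of n "Suc n"])
  qed
  then show "\<exists>x\<in>L'. norm x < r \<and> undesired R L' x"
    using f L' unfolding forced_def by blast
qed

lemma forced_mono:
  assumes "loc_finite L" "forced m A r R n (\<lambda>z. card (L \<inter> cell n z))" "n \<le> k"
  shows "forced m A r R k (\<lambda>z. card (L \<inter> cell k z))"
  using assms(3,2) by (induction rule: dec_induct) (auto intro: forced_Suc[OF assms(1)])

text \<open>
  With \<open>A = {}\<close> every cell of the window is prescribed, so the conclusion is about the actual
  configuration.
\<close>

lemma forced_fill: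
  assumes L: "loc_finite L" and f: "forced m A r R n (\<lambda>z. card (L \<inter> cell n z))"
    and two: "\<forall>a\<in>A. card (L \<inter> cell m a) = 2" and n: "m \<le> n" "\<And>a x. a \<in> A \<Longrightarrow> x \<in> cell m a \<Longrightarrow> norm x \<le> real n"
  shows "forced m {} r R n (\<lambda>z. card (L \<inter> cell n z))"
  unfolding forced_def
proof (intro allI impI)
  fix L' assume L': "loc_finite L'" "\<forall>z\<in>outer m {} n. card (L' \<inter> cell n z) = card (L \<inter> cell n z)"
  then have eq: "card (L' \<inter> cell n z) = card (L \<inter> cell n z)" if "z \<in> window n" for z
    using that by (auto simp: outer_def)
  have "card (L' \<inter> cell m a) = 2" if a: "a \<in> A" for a
  proof -
    have "w \<in> window n" if "w \<in> snap n ` cell m a" for w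
      using that n(2)[OF a] snap_in_window by auto
    then have "card (L' \<inter> cell m a) = card (L \<inter> cell m a)"
      using eq by (simp add: card_cell_refine[OF L n(1)] card_cell_refine[OF L'(1) n(1)])
    then show ?thesis using two a by simp
  qed
  moreover have "\<forall>z\<in>outer m A n. card (L' \<inter> cell n z) = card (L \<inter> cell n z)"
    using eq by (auto simp: outer_def)
  ultimately show "\<exists>x\<in>L'. norm x < r \<and> undesired R L' x"
    using f L'(1) unfolding forced_def by blast
qed

text \<open>The shifted counts of \<open>L\<close> are the counts of its translate by
  \<open>- v\<close>; the undesired point found in the translate is moved back.\<close>

lemma forced_translate:
  assumes L: "loc_finite (L :: 'a::euclidean_space set)" and v: "v \<in> integral_points"
    and f: "forced m {} r R n (\<lambda>z. card (L \<inter> cell n (z + 2 ^ n *\<^sub>R v)))"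
  obtains x where "x \<in> L" "norm (x - v) < r" "undesired R L x"
proof -
  define L' where "L' = (\<lambda>x. x - v) ` L"
  have shift: "(+) v ` L' = L" by (auto simp: L'_def image_image)
  have "loc_finite L'"
    unfolding loc_finite_def
  proof (intro allI impI)
    fix B :: "'a set" assume "bounded B"
    then have "bounded ((+) v ` B)" by (rule bounded_translation)
    then have "finite ((\<lambda>x. x - v) ` (L \<inter> (+) v ` B))" using L by (simp add: loc_finite_def)
    moreover have "L' \<inter> B \<subseteq> (\<lambda>x. x - v) ` (L \<inter> (+) v ` B)" by (force simp: L'_def)
    ultimately show "finite (L' \<inter> B)" by (rule rev_finite_subset)
  qed
  moreover have "card (L' \<inter> cell n z) = card (L \<inter> cell n (z + 2 ^ n *\<^sub>R v))" for z
  proof -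
    have "snap n (x - v) = z \<longleftrightarrow> snap n x = z + 2 ^ n *\<^sub>R v" for x
      using snap_translate[OF v, of n "x - v"] by auto
    then have "L' \<inter> cell n z = (\<lambda>x. x - v) ` (L \<inter> cell n (z + 2 ^ n *\<^sub>R v))"
      by (auto simp: L'_def cell_def)
    then show ?thesis by (simp add: card_image inj_on_def)
  qed
  ultimately obtain x where x: "x \<in> L'" "norm x < r" "undesired R L' x"
    using f unfolding forced_def by auto
  show thesis
    using that[of "v + x"] x undesired_translate[OF x(3), of v] shift by auto
qed

section \<open>Absence of ties and existence of close pairs\<close>

context intense_poisson_point_process
begin

text \<open>An isosceles triangle with apex and one base point in the ball of radius
  \<open>K\<close> occupies, at every fine level, two cells of the ball and a third cell in an
  annulus with width proportional to the mesh. The union bound for this is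
  \<open>b1 K n ^ 2 * b2 K n\<close>, where \<open>b1\<close> stays bounded and \<open>b2\<close>
  tends to 0.\<close>

lemma AE_no_isosceles: "AE \<omega> in M. no_isosceles (L \<omega>)"
proof -
  define rep where "rep n z = (SOME p. snap n p = z)" for n and z :: 'a
  define cells :: "nat \<Rightarrow> nat \<Rightarrow> 'a set" where "cells K n = snap n ` cball 0 (real K)" for K n
  \<comment> \<open>Replacing two points by the representatives of their cells changes their
    distance by at most two meshes; the third mesh makes the inequalities strict.\<close>
  define near where "near n z w = shell n (dist (rep n z) (rep n w) - 3 * mesh TYPE('a) n)
    (dist (rep n z) (rep n w) + 3 * mesh TYPE('a) n) z" for n and z w :: 'a
  define F where "F K n = {Z. card Z = 3 \<and> (\<exists>z\<in>cells K n. \<exists>w\<in>cells K n. \<exists>y\<in>near n z w. Z = {z, w, y})}" for K n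
  have rep: "snap n (rep n (snap n x)) = snap n x" for n x
    unfolding rep_def by (rule someI) (rule refl)
  have rep_dist: "dist (rep n (snap n x)) x \<le> mesh TYPE('a) n" for n x
    using snap_dist[OF rep] .
  have cells: "finite (cells K n)" "cells K n \<subseteq> integral_points" for K n
    by (auto simp: cells_def finite_snap_image snap_integral)
  define b1 where "b1 K n = intensity * (unit_ball_vol (real DIM('a)) * (real K + mesh TYPE('a) n) ^ DIM('a))" for K n
  \<comment> \<open>The 10 is the width \<open>3 + 3\<close> of the shell plus 4 from
    \<open>shell_mean\<close>; the 7 adds 3 and 2 to the 2 meshes by which two representatives can
    exceed the distance \<open>2 * real K\<close>.\<close>
  define b2 where "b2 K n = intensity * shell_const TYPE('a) * (10 * mesh TYPE('a) n) * (2 * real K + 7 * mesh TYPE('a) n) ^ (DIM('a) - 1)" for K n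
  have b1: "real (card (cells K n)) * cell_mean n \<le> b1 K n" for K n
  proof -
    have "real (card (cells K n)) * (1 / 2 ^ n) ^ DIM('a) \<le> measure lborel (cball (0::'a) (real K + mesh TYPE('a) n))"
    proof (rule card_cells_le_measure[OF cells])
      show "(\<Union>z\<in>cells K n. cell n z) \<subseteq> cball 0 (real K + mesh TYPE('a) n)"
      proof (intro UN_least subsetI)
        fix z x assume "z \<in> cells K n" "x \<in> cell n z"
        then obtain y where "norm y \<le> real K" "snap n x = snap n y" by (auto simp: cells_def cell_def)
        then show "x \<in> cball 0 (real K + mesh TYPE('a) n)"
          using snap_dist[of n x y] dist_triangle[of x 0 y] by simp
      qed
    qed auto
    also have "\<dots> = unit_ball_vol (real DIM('a)) * (real K + mesh TYPE('a) n) ^ DIM('a)"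
      using mesh_pos[where 'a = 'a, of n] by (intro content_cball) simp
    finally show ?thesis
      using intensity_pos by (simp add: b1_def cell_mean_def mult_left_mono mult.left_commute)
  qed
  have b2: "finite (near n z w)" "near n z w \<subseteq> integral_points" "real (card (near n z w)) * cell_mean n \<le> b2 K n"
    if zw: "z \<in> cells K n" "w \<in> cells K n" for z w K n
  proof -
    let ?D = "dist (rep n z) (rep n w)" and ?e = "mesh TYPE('a) n"
    have e: "?e > 0" by (rule mesh_pos)
    have ts: "0 < ?D + 3 * ?e" "?D - 3 * ?e < ?D + 3 * ?e" using e by (auto intro: add_nonneg_pos)
    show "finite (near n z w)" unfolding near_def by (rule shell_card(1)[OF ts])
    show "near n z w \<subseteq> integral_points" unfolding near_def by (rule shell_integral)
    have "?D \<le> 2 * real K + 2 * ?e"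
    proof -
      obtain x y where "z = snap n x" "w = snap n y" "norm x \<le> real K" "norm y \<le> real K"
        using zw by (auto simp: cells_def)
      then show ?thesis
        using rep_dist[of n x] rep_dist[of n y] dist_triangle[of "rep n z" "rep n w" 0]
          dist_triangle[of "rep n z" 0 x] dist_triangle[of "rep n w" 0 y] by (simp add: dist_commute)
    qed
    then have "intensity * shell_const TYPE('a) * (?D + 3 * ?e - (?D - 3 * ?e) + 4 * ?e) * (?D + 3 * ?e + 2 * ?e) ^ (DIM('a) - 1) \<le> b2 K n"
      unfolding b2_def using intensity_pos e
      by (intro mult_mono power_mono) (auto simp: shell_const_def intro!: mult_nonneg_nonneg)
    then show "real (card (near n z w)) * cell_mean n \<le> b2 K n"
      unfolding near_def using shell_mean[OF ts, of n z] by simp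
  qed
  have F: "finite (F K n)" "real (card (F K n)) * cell_mean n ^ 3 \<le> b1 K n ^ 2 * b2 K n" for K n
  proof -
    let ?U = "\<Union>z\<in>cells K n. \<Union>w\<in>cells K n. (\<lambda>y. {z, w, y}) ` near n z w"
    have sub: "F K n \<subseteq> ?U" by (auto simp: F_def)
    have U: "finite ?U" using cells b2(1) by (intro finite_UN_I finite_imageI) auto
    show "finite (F K n)" using sub U by (rule finite_subset)
    have "card (F K n) \<le> card ?U" by (rule card_mono[OF U sub])
    also have "\<dots> \<le> (\<Sum>z\<in>cells K n. card (\<Union>w\<in>cells K n. (\<lambda>y. {z, w, y}) ` near n z w))"
      by (rule card_UN_le[OF cells(1)])
    also have "\<dots> \<le> (\<Sum>z\<in>cells K n. \<Sum>w\<in>cells K n. card ((\<lambda>y. {z, w, y}) ` near n z w))"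
      by (intro sum_mono card_UN_le cells)
    also have "\<dots> \<le> (\<Sum>z\<in>cells K n. \<Sum>w\<in>cells K n. card (near n z w))"
      by (intro sum_mono card_image_le b2(1))
    finally have "real (card (F K n)) \<le> real (\<Sum>z\<in>cells K n. \<Sum>w\<in>cells K n. card (near n z w))"
      by (rule of_nat_mono)
    then have "real (card (F K n)) * cell_mean n \<le> (\<Sum>z\<in>cells K n. \<Sum>w\<in>cells K n. real (card (near n z w))) * cell_mean n"
      by (intro mult_right_mono cell_mean_nonneg) simp
    also have "\<dots> = (\<Sum>z\<in>cells K n. \<Sum>w\<in>cells K n. real (card (near n z w)) * cell_mean n)"
      by (simp add: sum_distrib_right)
    also have "\<dots> \<le> (\<Sum>z\<in>cells K n. \<Sum>w\<in>cells K n. b2 K n)"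
      by (intro sum_mono b2(3))
    finally have "real (card (F K n)) * cell_mean n * cell_mean n ^ 2 \<le> (real (card (cells K n)) ^ 2 * b2 K n) * cell_mean n ^ 2"
      by (intro mult_right_mono zero_le_power cell_mean_nonneg) (simp add: power2_eq_square mult.assoc)
    also have "\<dots> = (real (card (cells K n)) * cell_mean n) ^ 2 * b2 K n"
      by (simp add: power_mult_distrib)
    also have "\<dots> \<le> b1 K n ^ 2 * b2 K n"
      using intensity_pos mesh_pos[where 'a = 'a, of n]
      by (intro mult_right_mono power_mono b1 mult_nonneg_nonneg cell_mean_nonneg) (auto simp: b2_def shell_const_def)
    finally show "real (card (F K n)) * cell_mean n ^ 3 \<le> b1 K n ^ 2 * b2 K n"
      by (simp add: power3_eq_cube power2_eq_square mult.assoc)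
  qed
  have F3: "finite Z \<and> Z \<subseteq> integral_points \<and> card Z = 3" if "Z \<in> F K n" for Z K n
    using that cells(2)[of K n] b2(2)[of _ K n] by (auto simp: F_def)
  have "AE \<omega> in M. \<exists>\<^sub>F n in sequentially. \<omega> \<notin> some_occupied n (F K n)" for K
  proof (rule AE_frequently_not)
    show "some_occupied n (F K n) \<in> events" for n by (rule some_occupied(1)[OF F(1) F3])
    have le: "prob (some_occupied n (F K n)) \<le> b1 K n ^ 2 * b2 K n" for n
      by (rule order_trans[OF some_occupied(2)[OF F(1) F3] F(2)])
    have "(\<lambda>n. b1 K n ^ 2 * b2 K n) \<longlonglongrightarrow>
      (intensity * (unit_ball_vol (real DIM('a)) * (real K + 0) ^ DIM('a))) ^ 2 *
      (intensity * shell_const TYPE('a) * (10 * 0) * (2 * real K + 7 * 0) ^ (DIM('a) - 1))"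
      unfolding b1_def b2_def by (intro tendsto_intros mesh_tendsto)
    then have lim: "(\<lambda>n. b1 K n ^ 2 * b2 K n) \<longlonglongrightarrow> 0" by simp
    show "(\<lambda>n. prob (some_occupied n (F K n))) \<longlonglongrightarrow> 0"
    proof (rule tendsto_sandwich[where f = "\<lambda>_. 0" and h = "\<lambda>n. b1 K n ^ 2 * b2 K n"])
      show "\<forall>\<^sub>F n in sequentially. prob (some_occupied n (F K n)) \<le> b1 K n ^ 2 * b2 K n"
        by (intro always_eventually allI le)
    qed (use lim in auto)
  qed
  then have "AE \<omega> in M. \<forall>K. \<exists>\<^sub>F n in sequentially. \<omega> \<notin> some_occupied n (F K n)"
    by (simp add: AE_all_countable)
  with AE_loc_finite AE_space show ?thesis
  proof eventually_elim
    case (elim \<omega>)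
    show ?case
      unfolding no_isosceles_def
    proof (intro ballI inj_onI, rule ccontr)
      fix x y z assume L: "x \<in> L \<omega>" "y \<in> L \<omega>" "z \<in> L \<omega>" and d: "dist x y = dist x z" and yz: "y \<noteq> z"
      have ne: "x \<noteq> y" "x \<noteq> z" using d yz by auto
      obtain K :: nat where K: "norm x + norm y \<le> real K" using real_arch_simple by blast
      define e where "e = min (dist x y) (dist y z)"
      have "e > 0" using ne yz by (simp add: e_def)
      from eventually_mesh_less[OF this, of 1, where 'a = 'a]
      have "\<forall>\<^sub>F n in sequentially. \<omega> \<in> some_occupied n (F K n)"
      proof eventually_elim
        case (elim n)
        have sne: "snap n x \<noteq> snap n y" "snap n x \<noteq> snap n z" "snap n y \<noteq> snap n z"
          using elim snap_dist[of n x y] snap_dist[of n x z] snap_dist[of n y z] d by (auto simp: e_def)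
        have "snap n z \<in> near n (snap n x) (snap n y)"
          unfolding near_def shell_def
        proof (intro CollectI exI conjI)
          show "dist (rep n (snap n x)) (rep n (snap n y)) - 3 * mesh TYPE('a) n < dist x z"
            "dist x z < dist (rep n (snap n x)) (rep n (snap n y)) + 3 * mesh TYPE('a) n"
            using rep_dist[of n x] rep_dist[of n y] mesh_pos[where 'a = 'a, of n] d
              dist_triangle[of x y "rep n (snap n x)"] dist_triangle[of "rep n (snap n x)" y "rep n (snap n y)"]
              dist_triangle[of "rep n (snap n x)" "rep n (snap n y)" x] dist_triangle[of x "rep n (snap n y)" y]
            by (auto simp: dist_commute)
        qed simp_all
        moreover have "snap n x \<in> cells K n" "snap n y \<in> cells K n"
          using K norm_ge_zero[of x] norm_ge_zero[of y] unfolding cells_def by (auto intro!: imageI simp del: norm_ge_zero)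
        moreover have "card {snap n x, snap n y, snap n z} = 3" using sne by simp
        ultimately have "{snap n x, snap n y, snap n z} \<in> F K n" unfolding F_def by blast
        moreover have "count n (snap n u) \<omega> > 0" if "u \<in> L \<omega>" for u
          using that finite_cell[OF \<open>loc_finite (L \<omega>)\<close>] by (auto simp: count_def card_gt_0_iff cell_def)
        then have "\<forall>w\<in>{snap n x, snap n y, snap n z}. count n w \<omega> > 0" using L by simp
        ultimately show ?case
          unfolding some_occupied_def using \<open>\<omega> \<in> space M\<close> by blast
      qed
      then show False
        using \<open>\<forall>K. \<exists>\<^sub>F n in sequentially. \<omega> \<notin> some_occupied n (F K n)\<close> by (auto simp: frequently_def)
    qed
  qed
qed

text \<open>Of infinitely many disjoint cells with diameter below \<open>c\<close>, each
  independently holds exactly two points with the same positive probability.\<close>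

lemma AE_close_pair:
  assumes "c > 0"
  shows "AE \<omega> in M. \<exists>x\<in>L \<omega>. \<exists>y\<in>L \<omega>. x \<noteq> y \<and> dist x y \<le> c"
proof -
  obtain n where n: "1 * mesh TYPE('a) n < c"
    using eventually_mesh_less[OF assms, of 1, where 'a = 'a] by (auto simp: eventually_sequentially)
  obtain b :: 'a where b: "b \<in> Basis" using SOME_Basis by blast
  define z where "z i = real i *\<^sub>R b" for i :: nat
  have z: "z i \<in> integral_points" for i
    using b by (auto simp: z_def integral_points_def inner_Basis)
  have inj: "inj z" using b by (auto simp: z_def inj_def)
  define q where "q = cell_mean n ^ 2 / fact 2 * exp (- cell_mean n)"
  have q: "prob {\<omega> \<in> space M. count n (z i) \<omega> = 2} = q" for i
    using prob_cell_count[OF z] by (simp add: q_def)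
  have q0: "q > 0" using cell_mean_pos[of n] by (simp add: q_def)
  have q1: "q \<le> 1" using prob_le_1[of "{\<omega> \<in> space M. count n (z 0) \<omega> = 2}"] q[of 0] by simp
  define E where "E k = {\<omega> \<in> space M. \<forall>y\<in>z ` {..k}. count n y \<omega> \<noteq> 2}" for k
  have "prob (E k) = (1 - q) ^ Suc k" for k
  proof -
    have "E k = (\<Inter>y\<in>z ` {..k}. count n y -` (- {2}) \<inter> space M)" by (auto simp: E_def)
    then have "prob (E k) = (\<Prod>y\<in>z ` {..k}. prob (count n y -` (- {2}) \<inter> space M))"
      by (simp only:) (rule indep_varsD_finite[OF indep_cell_counts], auto)
    also have "\<dots> = (\<Prod>y\<in>z ` {..k}. 1 - q)"
    proof (rule prod.cong[OF refl])
      fix y assume "y \<in> z ` {..k}"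
      then obtain i where y: "y = z i" by auto
      have "count n y -` (- {2}) \<inter> space M = space M - {\<omega> \<in> space M. count n y \<omega> = 2}" by auto
      then show "prob (count n y -` (- {2}) \<inter> space M) = 1 - q" by (simp add: prob_compl q y)
    qed
    also have "\<dots> = (1 - q) ^ Suc k" using inj by (simp add: card_image inj_on_subset[OF inj])
    finally show ?thesis .
  qed
  moreover have "(\<lambda>k. (1 - q) ^ Suc k) \<longlonglongrightarrow> 0"
    using q0 q1 by (intro LIMSEQ_Suc LIMSEQ_realpow_zero) auto
  ultimately have "(\<lambda>k. prob (E k)) \<longlonglongrightarrow> 0" by simp
  then have "AE \<omega> in M. \<exists>\<^sub>F k in sequentially. \<omega> \<notin> E k"
    by (rule AE_frequently_not[rotated]) (unfold E_def, measurable)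
  with AE_space show ?thesis
  proof eventually_elim
    case (elim \<omega>)
    then obtain k where "\<omega> \<notin> E k" by (auto dest: frequently_ex)
    then obtain y where "count n y \<omega> = 2" using elim(1) by (auto simp: E_def)
    then obtain u v where "L \<omega> \<inter> cell n y = {u, v}" "u \<noteq> v" by (auto simp: count_def card_2_iff)
    then have "u \<in> L \<omega> \<inter> cell n y" "v \<in> L \<omega> \<inter> cell n y" "u \<noteq> v" by auto
    then have "u \<in> L \<omega>" "v \<in> L \<omega>" "snap n u = snap n v" "u \<noteq> v" by (auto simp: cell_def)
    then show ?case using snap_dist[of n u v] n by (intro bexI[of _ u] bexI[of _ v]) auto
  qed
qed


section \<open>Events determined by finitely many counts\<close>

definition pattern_event :: "nat \<Rightarrow> 'a set \<Rightarrow> 'a \<Rightarrow> (('a \<Rightarrow> nat) \<Rightarrow> bool) \<Rightarrow> 'w set" where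
  "pattern_event n W v P = {\<omega> \<in> space M. P (\<lambda>z\<in>W. count n (z + v) \<omega>)}"

text \<open>The finite product of these discrete spaces is discrete, so an arbitrary predicate on
  patterns defines an event.\<close>

lemma sets_PiM_count_space:
  assumes "finite W"
  shows "sets (PiM W (\<lambda>_. count_space (UNIV :: nat set))) = Pow (PiE W (\<lambda>_. UNIV))"
  using count_space_PiM_finite[OF assms, of "\<lambda>_. UNIV :: nat set"] by simp

lemma restrict_measurable:
  "(\<lambda>\<omega>. \<lambda>z\<in>W. count n (z + v) \<omega>) \<in> measurable M (PiM W (\<lambda>_. count_space UNIV))"
  by (rule measurable_restrict) simp

lemma pattern_event_vimage:
  "pattern_event n W v P =
    (\<lambda>\<omega>. \<lambda>z\<in>W. count n (z + v) \<omega>) -` {p \<in> PiE W (\<lambda>_. UNIV). P p} \<inter> space M"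
  by (auto simp: pattern_event_def)

lemma pattern_event_sets: "finite W \<Longrightarrow> pattern_event n W v P \<in> events"
  unfolding pattern_event_vimage
  by (rule measurable_sets[OF restrict_measurable]) (auto simp: sets_PiM_count_space)

lemma distr_cell_count:
  assumes "z \<in> integral_points" "w \<in> integral_points"
  shows "distr M (count_space UNIV) (count n z) = distr M (count_space UNIV) (count n w)"
proof (rule measure_eqI_countable[of _ UNIV])
  fix k
  have "emeasure (distr M (count_space UNIV) (count n y)) {k} =
      ennreal (cell_mean n ^ k / fact k * exp (- cell_mean n))" if "y \<in> integral_points" for y
  proof -
    have "count n y -` {k} \<inter> space M = {\<omega> \<in> space M. count n y \<omega> = k}" by auto
    then show ?thesis
      using prob_cell_count[OF that, of n k] by (simp add: emeasure_distr emeasure_eq_measure)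
  qed
  then show "emeasure (distr M (count_space UNIV) (count n z)) {k} =
      emeasure (distr M (count_space UNIV) (count n w)) {k}" using assms by simp
qed auto

text \<open>By independence the joint law of the counts is the product of their laws, and cells of
  one level have equal volume, hence equal laws.\<close>

lemma prob_pattern_translate:
  assumes W: "finite W" "W \<subseteq> integral_points" and v: "v \<in> integral_points"
  shows "prob (pattern_event n W v P) = prob (pattern_event n W 0 P)"
proof (cases "W = {}")
  case True
  then show ?thesis by (simp add: pattern_event_def restrict_def)
next
  case False
  let ?P = "PiM W (\<lambda>_. count_space (UNIV :: nat set))"
  have dist: "distr M ?P (\<lambda>\<omega>. \<lambda>z\<in>W. count n (z + u) \<omega>) = PiM W (\<lambda>z. distr M (count_space UNIV) (count n (z + u)))" for u
  proof -
    have "inj_on (\<lambda>z. z + u) W" by (simp add: inj_on_def)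
    then have "disjoint_family_on (\<lambda>z. cell n (z + u)) W"
      by (auto simp: disjoint_family_on_def cell_def)
    then have "indep_vars (\<lambda>_. count_space UNIV) (\<lambda>z. count n (z + u)) W"
      unfolding count_def[abs_def]
      by (rule indep_counts_family[OF W(1), rotated]) (simp add: cell_borel bounded_cell)
    then show ?thesis by (subst (asm) indep_vars_iff_distr_eq_PiM'[OF False]) simp_all
  qed
  have "z + v \<in> integral_points" if "z \<in> W" for z
    using that W(2) v by (auto simp: integral_points_def inner_add_left)
  then have "distr M (count_space UNIV) (count n (z + v)) = distr M (count_space UNIV) (count n (z + 0))" if "z \<in> W" for z
    using that W(2) by (intro distr_cell_count) auto
  then have eq: "distr M ?P (\<lambda>\<omega>. \<lambda>z\<in>W. count n (z + v) \<omega>) = distr M ?P (\<lambda>\<omega>. \<lambda>z\<in>W. count n (z + 0) \<omega>)"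
    unfolding dist by (intro PiM_cong refl)
  have "prob (pattern_event n W u P) = measure (distr M ?P (\<lambda>\<omega>. \<lambda>z\<in>W. count n (z + u) \<omega>)) {p \<in> PiE W (\<lambda>_. UNIV). P p}" for u
    unfolding pattern_event_vimage
    by (rule measure_distr[symmetric, OF restrict_measurable]) (auto simp: sets_PiM_count_space[OF W(1)])
  then show ?thesis by (simp only: eq)
qed

lemma prob_pattern_pairs:
  assumes W: "finite W" "W \<subseteq> integral_points" and A: "finite A" "A \<subseteq> integral_points"
    and disj: "\<And>z a. z \<in> W \<Longrightarrow> a \<in> A \<Longrightarrow> cell n z \<inter> cell m a = {}"
  shows "prob (pattern_event n W 0 P \<inter> {\<omega> \<in> space M. \<forall>a\<in>A. count m a \<omega> = 2}) =
    prob (pattern_event n W 0 P) * (cell_mean m ^ 2 / 2 * exp (- cell_mean m)) ^ card A"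
proof -
  \<comment> \<open>The sum type keeps the two levels apart, as the same lattice point may index a
    cell of each.\<close>
  define B :: "'a + 'a \<Rightarrow> 'a set" where "B = case_sum (cell n) (cell m)"
  define X where "X i \<omega> = card (L \<omega> \<inter> B i)" for i \<omega>
  have X: "X (Inl z) = count n z" "X (Inr a) = count m a" for z a
    by (auto simp: X_def B_def count_def)
  have ind: "indep_vars (\<lambda>_. count_space UNIV) X (Inl ` W \<union> Inr ` A)"
    unfolding X_def[abs_def]
  proof (rule indep_counts_family)
    show "disjoint_family_on B (Inl ` W \<union> Inr ` A)"
      unfolding disjoint_family_on_def B_def
    proof (intro ballI impI)
      fix i j :: "'a + 'a" assume "i \<in> Inl ` W \<union> Inr ` A" "j \<in> Inl ` W \<union> Inr ` A" "i \<noteq> j"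
      then show "case_sum (cell n) (cell m) i \<inter> case_sum (cell n) (cell m) j = {}"
        using disj by (cases i; cases j) (auto simp: Int_commute cell_disjoint)
    qed
  qed (use W A in \<open>auto simp: B_def cell_borel bounded_cell\<close>)
  let ?M = "\<lambda>_::'a + 'a. count_space (UNIV :: nat set)"
  have iv: "indep_var (PiM (Inl ` W) ?M) (\<lambda>\<omega>. \<lambda>i\<in>Inl ` W. X i \<omega>) (PiM (Inr ` A) ?M) (\<lambda>\<omega>. \<lambda>i\<in>Inr ` A. X i \<omega>)"
    by (rule indep_var_restrict[OF ind]) auto
  define S :: "('a + 'a \<Rightarrow> nat) set" where "S = {p \<in> PiE (Inl ` W) (\<lambda>_. UNIV :: nat set). P (\<lambda>z\<in>W. p (Inl z))}"
  define T :: "('a + 'a \<Rightarrow> nat) set" where "T = {p \<in> PiE (Inr ` A) (\<lambda>_. UNIV :: nat set). \<forall>a\<in>A. p (Inr a) = 2}"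
  have ST: "S \<in> sets (PiM (Inl ` W) ?M)" "T \<in> sets (PiM (Inr ` A) ?M)"
    using W A by (auto simp: S_def T_def count_space_PiM_finite)
  have "(\<lambda>z\<in>W. (\<lambda>i\<in>Inl ` W. X i \<omega>) (Inl z)) = (\<lambda>z\<in>W. count n (z + 0) \<omega>)" for \<omega>
    by (auto simp: X)
  then have S: "(\<lambda>\<omega>. \<lambda>i\<in>Inl ` W. X i \<omega>) -` S \<inter> space M = pattern_event n W 0 P"
    by (auto simp: S_def pattern_event_def)
  have T: "(\<lambda>\<omega>. \<lambda>i\<in>Inr ` A. X i \<omega>) -` T \<inter> space M = {\<omega> \<in> space M. \<forall>a\<in>A. count m a \<omega> = 2}"
    by (auto simp: T_def X)
  have "prob (pattern_event n W 0 P \<inter> {\<omega> \<in> space M. \<forall>a\<in>A. count m a \<omega> = 2}) =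
    prob (pattern_event n W 0 P) * prob {\<omega> \<in> space M. \<forall>a\<in>A. count m a \<omega> = 2}"
    using indep_varD[OF iv ST] unfolding S[symmetric] T[symmetric]
    by (auto simp: vimage_def Int_def conj_ac intro: arg_cong[where f = prob])
  also have "prob {\<omega> \<in> space M. \<forall>a\<in>A. count m a \<omega> = 2} = (cell_mean m ^ 2 / 2 * exp (- cell_mean m)) ^ card A"
  proof (cases "A = {}")
    case False
    have "{\<omega> \<in> space M. \<forall>a\<in>A. count m a \<omega> = 2} = (\<Inter>a\<in>A. count m a -` {2} \<inter> space M)" using False by auto
    then have "prob {\<omega> \<in> space M. \<forall>a\<in>A. count m a \<omega> = 2} = (\<Prod>a\<in>A. prob (count m a -` {2} \<inter> space M))"
      by (simp only:) (rule indep_varsD_finite[OF indep_cell_counts], use A False in auto)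
    also have "\<dots> = (\<Prod>a\<in>A. cell_mean m ^ 2 / 2 * exp (- cell_mean m))"
    proof (rule prod.cong[OF refl])
      fix a assume "a \<in> A"
      moreover have "count m a -` {2} \<inter> space M = {\<omega> \<in> space M. count m a \<omega> = 2}" by auto
      ultimately show "prob (count m a -` {2} \<inter> space M) = cell_mean m ^ 2 / 2 * exp (- cell_mean m)"
        using A(2) prob_cell_count[of a m 2] by (auto simp: fact_2)
    qed
    finally show ?thesis by simp
  qed (simp add: prob_space)
  finally show ?thesis .
qed

section \<open>Undesired points have probability zero\<close>

definition forced_event :: "nat \<Rightarrow> 'a set \<Rightarrow> real \<Rightarrow> real \<Rightarrow> nat \<Rightarrow> 'a \<Rightarrow> 'w set" where
  "forced_event m A r R n v = {\<omega> \<in> space M. forced m A r R n (\<lambda>z. count n (z + 2 ^ n *\<^sub>R v) \<omega>)}"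

lemma forced_event_pattern:
  "forced_event m A r R n v = pattern_event n (outer m A n) (2 ^ n *\<^sub>R v) (forced m A r R n)"
  by (simp add: forced_event_def pattern_event_def forced_restrict)

lemma forced_event_sets: "forced_event m A r R n v \<in> events"
  unfolding forced_event_pattern by (rule pattern_event_sets[OF finite_outer])

lemma prob_forced_translate:
  assumes "v \<in> integral_points"
  shows "prob (forced_event m A r R n v) = prob (forced_event m A r R n 0)"
proof -
  have "2 ^ n *\<^sub>R v \<in> integral_points" using assms by (auto simp: integral_points_def)
  then show ?thesis
    unfolding forced_event_pattern by (simp add: prob_pattern_translate finite_outer outer_integral)
qed

text \<open>The two undesired points are within \<open>R\<close> of each other, hence equal, but
  they lie in disjoint balls.\<close>

lemma forced_event_separated:
  assumes lf: "loc_finite (L \<omega>)" and vw: "v \<in> integral_points" "w \<in> integral_points" "2 * r \<le> dist v w" "dist v w + 2 * r \<le> R"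
    and "\<omega> \<in> forced_event m {} r R n v" "\<omega> \<in> forced_event m {} r R n w"
  shows False
proof -
  obtain x where x: "x \<in> L \<omega>" "norm (x - v) < r" "undesired R (L \<omega>) x"
    using forced_translate[OF lf vw(1), of m r R n] assms(6) by (auto simp: forced_event_def count_def)
  obtain y where y: "y \<in> L \<omega>" "norm (y - w) < r" "undesired R (L \<omega>) y"
    using forced_translate[OF lf vw(2), of m r R n] assms(7) by (auto simp: forced_event_def count_def)
  have d: "dist x v < r" "dist y w < r" using x y by (auto simp: dist_norm)
  then have "dist x y < R"
    using vw dist_triangle[of x y v] dist_triangle[of v y w] by (simp add: dist_commute)
  then have "x = y" by (rule undesired_separated[OF x(3) y(3)])
  then show False using d vw(3) dist_triangle[of v w x] by (simp add: dist_commute)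
qed

lemma prob_forced_le:
  assumes r: "r > 0" and K: "R \<ge> 2 * r * real K + 2 * r"
  shows "real K * prob (forced_event m {} (real r) R n 0) \<le> 1"
proof -
  obtain b :: 'a where b: "b \<in> Basis" using SOME_Basis by blast
  \<comment> \<open>Spacing \<open>2 * r\<close> makes the balls disjoint, and all \<open>K\<close>
    of them fit into the range allowed by \<open>R\<close>.\<close>
  define v where "v i = real (2 * r * i) *\<^sub>R b" for i
  have v: "v i \<in> integral_points" for i
    using b by (auto simp: v_def integral_points_def inner_Basis)
  let ?E = "\<lambda>i. forced_event m {} (real r) R n (v i)"
  have "(\<Sum>i<K. prob (?E i)) = prob (\<Union>i<K. ?E i)"
  proof (rule measure_UNION_AE[symmetric])
    show "?E i \<in> fmeasurable M" for i by (simp add: fmeasurable_eq_sets forced_event_sets)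
    show "pairwise (\<lambda>i j. AE \<omega> in M. \<omega> \<notin> ?E i \<or> \<omega> \<notin> ?E j) {..<K}"
    proof (rule pairwiseI)
      fix i j assume ij: "i \<in> {..<K}" "j \<in> {..<K}" "i \<noteq> j"
      have "dist (v i) (v j) = real (2 * r) * \<bar>real i - real j\<bar>"
        using b by (simp add: v_def dist_norm abs_mult flip: scaleR_diff_left right_diff_distrib)
      moreover have "1 \<le> \<bar>real i - real j\<bar>" "\<bar>real i - real j\<bar> \<le> real K" using ij by auto
      then have "real (2 * r) * 1 \<le> real (2 * r) * \<bar>real i - real j\<bar>"
        "real (2 * r) * \<bar>real i - real j\<bar> \<le> real (2 * r) * real K"
        by (intro mult_left_mono; simp)+
      ultimately have "2 * real r \<le> dist (v i) (v j)" "dist (v i) (v j) + 2 * real r \<le> R"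
        using K by simp_all
      with AE_loc_finite show "AE \<omega> in M. \<omega> \<notin> ?E i \<or> \<omega> \<notin> ?E j"
        using forced_event_separated[OF _ v v] by (auto elim!: eventually_mono)
    qed
  qed auto
  also have "\<dots> \<le> 1" by (rule prob_le_1)
  finally show ?thesis by (simp add: prob_forced_translate[OF v])
qed

text \<open>If \<open>S\<close> had positive probability, filling the \<open>A\<close>-cells would
  give the events with \<open>A = {}\<close> a probability bounded below uniformly in
  \<open>R\<close>, against \<open>prob_forced_le\<close> for large \<open>K\<close>.\<close>

lemma AE_not_forced:
  assumes A: "finite A" "A \<subseteq> integral_points" and r: "r > 0"
  shows "AE \<omega> in M. \<not> (\<forall>R::nat. \<exists>n. \<omega> \<in> forced_event m A (real r) (real R) n 0)"
proof -
  let ?V = "\<lambda>R n. forced_event m A (real r) (real R) n 0"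
  define S where "S = (\<Inter>R::nat. \<Union>n. ?V R n)"
  have S: "S \<in> events" unfolding S_def using forced_event_sets by (intro sets.countable_INT sets.countable_UN) auto
  define q where "q = (cell_mean m ^ 2 / 2 * exp (- cell_mean m)) ^ card A"
  have q: "q > 0" using cell_mean_pos[of m] by (simp add: q_def)
  have bound: "\<exists>n. prob S / 2 * q \<le> prob (forced_event m {} (real r) (real R) n 0)" if pos: "prob S > 0" for R
  proof -
    \<comment> \<open>The unions increase everywhere, whereas monotonicity in the level is available
      only for locally finite configurations.\<close>
    define V where "V n = (\<Union>k\<le>n. ?V R k)" for n
    have V: "V n \<in> events" for n unfolding V_def using forced_event_sets by (intro sets.finite_UN) auto
    have lim: "(\<lambda>n. prob (V n)) \<longlonglongrightarrow> prob (\<Union>n. V n)"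
      by (rule finite_Lim_measure_incseq) (use V in \<open>auto simp: incseq_def V_def intro: order_trans\<close>)
    have "S \<subseteq> (\<Union>n. V n)" by (auto simp: S_def V_def)
    then have "prob S \<le> prob (\<Union>n. V n)" using V by (intro finite_measure_mono) auto
    then have "prob S / 2 < prob (\<Union>n. V n)" using pos by simp
    from order_tendstoD(1)[OF lim this] obtain n1 where n1: "\<And>n. n \<ge> n1 \<Longrightarrow> prob S / 2 < prob (V n)"
      by (auto simp: eventually_sequentially)
    have "bounded (\<Union>a\<in>A. cell m a)" using A(1) bounded_cell by (intro bounded_UN) auto
    then obtain B where B: "\<And>x. x \<in> (\<Union>a\<in>A. cell m a) \<Longrightarrow> norm x \<le> B" by (auto simp: bounded_iff)
    obtain n2 :: nat where n2: "B \<le> real n2" using real_arch_simple by blast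
    \<comment> \<open>The level must reach probability \<open>prob S / 2\<close>, have a window
      containing all \<open>A\<close>-cells, and refine level \<open>m\<close>.\<close>
    define n where "n = max n1 (max n2 m)"
    have n: "m \<le> n" "n1 \<le> n" "real n2 \<le> real n" by (auto simp: n_def)
    have small: "norm x \<le> real n" if "a \<in> A" "x \<in> cell m a" for a x
      using B[of x] that n2 n(3) by fastforce
    have "prob (V n) \<le> prob (?V R n)"
    proof (rule finite_measure_mono_AE[OF _ forced_event_sets])
      show "AE \<omega> in M. \<omega> \<in> V n \<longrightarrow> \<omega> \<in> ?V R n"
        using AE_loc_finite
      proof (rule AE_mp, intro AE_I2 impI)
        fix \<omega> assume "loc_finite (L \<omega>)" "\<omega> \<in> V n"
        then show "\<omega> \<in> ?V R n"
          using forced_mono[of "L \<omega>" m A "real r" "real R" _ n] by (auto simp: V_def forced_event_def count_def)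
      qed
    qed
    then have "prob S / 2 * q \<le> prob (?V R n) * q" using n1[OF n(2)] q by simp
    also have "\<dots> = prob (?V R n \<inter> {\<omega> \<in> space M. \<forall>a\<in>A. count m a \<omega> = 2})"
    proof -
      have "cell n z \<inter> cell m a = {}" if "z \<in> outer m A n" "a \<in> A" for z a
        using that by (auto simp: outer_def cell_def)
      then show ?thesis
        unfolding forced_event_pattern scaleR_zero_right q_def
        by (intro prob_pattern_pairs[symmetric] finite_outer outer_integral A)
    qed
    also have "\<dots> \<le> prob (forced_event m {} (real r) (real R) n 0)"
    proof (rule finite_measure_mono_AE[OF _ forced_event_sets])
      show "AE \<omega> in M. \<omega> \<in> ?V R n \<inter> {\<omega> \<in> space M. \<forall>a\<in>A. count m a \<omega> = 2} \<longrightarrow>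
        \<omega> \<in> forced_event m {} (real r) (real R) n 0"
        using AE_loc_finite
      proof (rule AE_mp, intro AE_I2 impI)
        fix \<omega> assume lf: "loc_finite (L \<omega>)" and \<omega>: "\<omega> \<in> ?V R n \<inter> {\<omega> \<in> space M. \<forall>a\<in>A. count m a \<omega> = 2}"
        then show "\<omega> \<in> forced_event m {} (real r) (real R) n 0"
          using forced_fill[OF lf _ _ n(1) small, where A = A and r = "real r" and R = "real R"]
          by (auto simp: forced_event_def count_def)
      qed
    qed
    finally show ?thesis ..
  qed
  have "prob S = 0"
  proof (rule ccontr)
    assume "prob S \<noteq> 0"
    then have pos: "prob S > 0" by (simp add: zero_less_measure_iff)
    then have "prob S / 2 * q > 0" using q by simp
    then obtain K :: nat where K: "1 < real K * (prob S / 2 * q)" using reals_Archimedean3 by blast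
    obtain n where n: "prob S / 2 * q \<le> prob (forced_event m {} (real r) (real (2 * r * K + 2 * r)) n 0)"
      using bound[OF pos] by blast
    have "real K * (prob S / 2 * q) \<le> real K * prob (forced_event m {} (real r) (real (2 * r * K + 2 * r)) n 0)"
      by (intro mult_left_mono n) simp
    also have "\<dots> \<le> 1" by (rule prob_forced_le[OF r]) simp
    finally show False using K by simp
  qed
  then have "AE \<omega> in M. \<omega> \<notin> S" using S by (simp add: prob_eq_0)
  then show ?thesis by (rule AE_mp) (auto simp: S_def)
qed

text \<open>A point violating the claim would by \<open>ex_modification_undesired\<close> put the
  configuration into one of countably many null events, indexed by \<open>m\<close>,
  \<open>A\<close> and an integer radius \<open>r\<close>.\<close>

lemma AE_desired_from_afar:
  "AE \<omega> in M. \<forall>x\<in>L \<omega>. \<exists>y\<in>L \<omega>. dist x y > c \<and> \<not> closer_matched (L \<omega>) y x"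
proof -
  let ?A = "{A :: 'a set. finite A \<and> A \<subseteq> integral_points}"
  have cA: "countable ?A"
    using countable_Collect_finite_subset[OF countable_integral_points] by simp
  have "AE \<omega> in M. \<forall>m. \<forall>A\<in>?A. \<forall>r::nat. r > 0 \<longrightarrow>
    \<not> (\<forall>R::nat. \<exists>n. \<omega> \<in> forced_event m A (real r) (real R) n 0)"
    unfolding AE_all_countable AE_ball_countable[OF cA]
  proof (intro allI ballI)
    fix m :: nat and A :: "'a set" and r :: nat assume "A \<in> ?A"
    then show "AE \<omega> in M. r > 0 \<longrightarrow> \<not> (\<forall>R::nat. \<exists>n. \<omega> \<in> forced_event m A (real r) (real R) n 0)"
      using AE_not_forced[of A r m] by (cases "r > 0") auto
  qed
  with AE_loc_finite AE_space show ?thesis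
  proof eventually_elim
    case (elim \<omega>)
    show ?case
    proof (rule ccontr)
      assume "\<not> ?thesis"
      then obtain x where x: "x \<in> L \<omega>" and far: "\<And>y. y \<in> L \<omega> \<Longrightarrow> dist y x > c \<Longrightarrow> closer_matched (L \<omega>) y x"
        by (auto simp: dist_commute)
      obtain r :: nat where r: "norm x < real r" using reals_Archimedean2 by blast
      have "\<exists>m A. finite A \<and> A \<subseteq> integral_points \<and>
          (\<forall>R. \<exists>n. \<forall>L'. modification m A n (L \<omega>) L' \<longrightarrow> (\<exists>x'\<in>L'. norm x' < real r \<and> undesired R L' x'))"
        by (rule ex_modification_undesired[OF elim(1) x _ r, where c = c]) (rule far)
      then obtain m A where mA: "finite A \<and> A \<subseteq> integral_points \<and>
          (\<forall>R. \<exists>n. \<forall>L'. modification m A n (L \<omega>) L' \<longrightarrow> (\<exists>x'\<in>L'. norm x' < real r \<and> undesired R L' x'))"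
        by (elim exE) (rule that)
      then have A: "A \<in> ?A" by simp
      have "\<exists>n. \<omega> \<in> forced_event m A (real r) (real R) n 0" for R :: nat
      proof -
        obtain n where "\<forall>L'. modification m A n (L \<omega>) L' \<longrightarrow> (\<exists>x'\<in>L'. norm x' < real r \<and> undesired (real R) L' x')"
          using mA by (elim conjE) (drule spec[of _ "real R"], elim exE, rule that)
        then have "\<omega> \<in> forced_event m A (real r) (real R) n 0"
          using elim(2) by (simp add: forced_event_def forced_def modification_def count_def)
        then show ?thesis ..
      qed
      moreover have "r > 0" using r norm_ge_zero[of x] by (cases r) auto
      ultimately show False using bspec[OF spec[OF elim(3), of m] A, THEN spec, of r] by simp
    qed
  qed
qed

end

theorem theorem7:
  fixes M :: "'w measure"
    and L :: "'w \<Rightarrow> 'a::euclidean_space set"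
    and intensity c :: real
  assumes "poisson_point_process M L intensity"
    and "intensity > 0"
    and "c > 0"
  shows "AE \<omega> in M.
           win_for (shy_friendly_frogs c (L \<omega>)) Alice \<and>
           win_for (shy_colored_friendly_frogs c (L \<omega>)) Bob"
proof -
  interpret poisson_point_process M L intensity by (rule assms(1))
  interpret intense_poisson_point_process M L intensity by unfold_locales (rule assms(2))
  show ?thesis
    using AE_wf_descent AE_no_isosceles AE_close_pair[OF assms(3)] AE_desired_from_afar[of c]
  proof eventually_elim
    case (elim \<omega>)
    then show ?case
      using Alice_wins_shy[OF elim(1)] Bob_wins_shy_colored[OF elim(1,2) _ assms(3)] by blast
  qed
qed

end
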